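(* (1) For every non-identity element $x$ of a $^\star$-involutive idempotent residuated chain $\mathbf A$, the set $\langle x\rangle$ is a layer-convex subset of the enhanced monoidal preorder of $\mathbf A$. (2) A non-trivial idempotent residuated chain is one-generated and $^\star$-involutive if and only if it is crownian.
   Context: A residuated lattice is an algebra $(A,\wedge,\vee,\cdot,\backslash,/,1)$ such that $(A,\wedge,\vee)$ is a lattice, $(A,\cdot,1)$ is a monoid, and $y\le x\backslash z \iff x\cdot y\le z\iff x\le z/y$. An idempotent residuated chain is a residuated lattice whose order is total and which satisfies $x\cdot x=x$. Define $x^r:=x\backslash 1$, $x^\ell:=1/x$, $x^\star:=x^\ell\wedge x^r$. It is $^\star$-involutive if $x^{\star\star}=x$ for all $x$. It is one-generated if it is generated as a residuated lattice by a single element. For an element $x$, $\langle x\rangle$ denotes the smallest set containing $x$ and closed under $^\ell$ and $^r$ (so the subalgebra generated by $x$ is $\langle x\rangle\cup\{1\}$). Monoidal preorder: $x\sqsubseteq y$ iff $xy=x$; this is a preorder on any idempotent residuated chain $\mathbf A$. Write $x\sqsubset y$ if $x\sqsubseteq y$ and $y\not\sqsubseteq x$. Put $A^+=\{x:x\ge 1\}$, $A^-=\{x:x\le 1\}$. The enhanced monoidal preorder of $\mathbf A$ is $(A,\sqsubseteq,A^+,A^-,1,{}^\star)$. Two elements are in the same layer if they have the same sets of strict $\sqsubset$-upper bounds and the same sets of strict $\sqsubset$-lower bounds; $\overline x$ denotes the layer of $x$, and layers are totally ordered by: $\overline x\le\overline y$ iff $x,y$ are in the same layer or $x\sqsubseteq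 y$. A subset $Q$ is layer-convex if $q_1,q_2\in Q$ and $\overline{q_1}\le\overline p\le\overline{q_2}$ imply $p\in Q$. Enhanced preorders: preordered sets $P$ with two distinguished subsets $P^+,P^-$. Let $\mathbf 1_L$ be a singleton with $P^+=P$, $P^-=\emptyset$; $\mathbf 1_R$ a singleton with $P^+=\emptyset$, $P^-=P$; $\mathbf 2_L=\{a,b\}$ with $P^+=\{a\}$, $P^-=\{b\}$, $a\sqsubseteq b$ and $b\sqsubseteq a$; $\mathbf 2_R=\{a,b\}$ with $P^+=\{a\}$, $P^-=\{b\}$ and $a,b$ incomparable. The ordinal sum $\bigoplus_{i\in I}\mathbf P_i$ over a chain $I$ is the disjoint union with $x\sqsubseteq y$ iff ($x\in P_i$, $y\in P_j$, $i<j$) or ($x,y\in P_i$ and $x\sqsubseteq_{P_i}y$), with positive and negative parts the unions of those of the summands ($\mathbf P\oplus\mathbf Q$: $\mathbf P$ below $\mathbf Q$). A vertical crown is one of the following, where the topmost summand $\mathbf 1_L$ is the identity element $1$, which is also added to $P^-$ (so $P^+\cap P^-=\{1\}$), $L\subseteq I$ is arbitrary, and $\mathbf P_i=\mathbf 2_L$ for $i\in L$, $\mathbf P_i=\mathbf 2_R$ for $i\in I\setminus L$: (a) $(\bigoplus_{i\in I}\mathbf P_i)\oplus\mathbf 1_L$ with $I=\mathbb Z$; (b) $\mathbf 1_R\oplus(\bigoplus_{i\in I}\mathbf P_i)\oplus\mathbf 1_L$ with $I=\mathbb N$; (c) $(\bigoplus_{i\in I}\mathbf P_i)\oplus\mathbf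 1_L\oplus\mathbf 1_L$ with $I=\mathbb N^\partial$ (the order dual of $\mathbb N$); (d) $\mathbf 1_R\oplus(\bigoplus_{i\in I}\mathbf P_i)\oplus\mathbf 1_L\oplus\mathbf 1_L$ with $I=\{1,\dots,n\}$, $n\ge 0$. An idempotent residuated chain $\mathbf A$ is crownian if $(A,\sqsubseteq,A^+,A^-)$ is isomorphic to a vertical crown (with $1$ corresponding to the identity element). *)

theory Defs
  imports Main
begin

section \<open>Idempotent residuated chains\<close>

class residuated_lattice = lattice + monoid_mult +
  fixes under :: "'a \<Rightarrow> 'a \<Rightarrow> 'a" (infixr "\<setminus>" 70)
    and over :: "'a \<Rightarrow> 'a \<Rightarrow> 'a" (infixl "\<sslash>" 70)
  assumes under_iff: "y \<le> x \<setminus> z \<longleftrightarrow> x * y \<le> z"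
    and over_iff: "x \<le> z \<sslash> y \<longleftrightarrow> x * y \<le> z"

class idempotent_residuated_chain = residuated_lattice + linorder +
  assumes mult_idem: "x * x = x"

definition rinv :: "'a::residuated_lattice \<Rightarrow> 'a" where
  "rinv x = x \<setminus> 1"

definition linv :: "'a::residuated_lattice \<Rightarrow> 'a" where
  "linv x = 1 \<sslash> x"

definition star :: "'a::residuated_lattice \<Rightarrow> 'a" where
  "star x = inf (linv x) (rinv x)"

definition star_involutive :: "'a::residuated_lattice itself \<Rightarrow> bool" where
  "star_involutive _ \<longleftrightarrow> (\<forall>x::'a. star (star x) = x)"

inductive_set subalgebra_gen :: "'a::residuated_lattice set \<Rightarrow> 'a set"
  for X :: "'a set" where
  gen: "x \<in> X \<Longrightarrow> x \<in> subalgebra_gen X"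
| one: "1 \<in> subalgebra_gen X"
| inf: "\<lbrakk>x \<in> subalgebra_gen X; y \<in> subalgebra_gen X\<rbrakk> \<Longrightarrow> inf x y \<in> subalgebra_gen X"
| sup: "\<lbrakk>x \<in> subalgebra_gen X; y \<in> subalgebra_gen X\<rbrakk> \<Longrightarrow> sup x y \<in> subalgebra_gen X"
| mult: "\<lbrakk>x \<in> subalgebra_gen X; y \<in> subalgebra_gen X\<rbrakk> \<Longrightarrow> x * y \<in> subalgebra_gen X"
| under: "\<lbrakk>x \<in> subalgebra_gen X; y \<in> subalgebra_gen X\<rbrakk> \<Longrightarrow> x \<setminus> y \<in> subalgebra_gen X"
| over: "\<lbrakk>x \<in> subalgebra_gen X; y \<in> subalgebra_gen X\<rbrakk> \<Longrightarrow> x \<sslash> y \<in> subalgebra_gen X"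

definition one_generated :: "'a::residuated_lattice itself \<Rightarrow> bool" where
  "one_generated _ \<longleftrightarrow> (\<exists>x::'a. subalgebra_gen {x} = UNIV)"

text \<open>The set written \<open>\<langle>x\<rangle>\<close> on paper; note that it is not required to contain \<open>1\<close>.\<close>

inductive_set inv_closure :: "'a::residuated_lattice \<Rightarrow> 'a set"
  for x :: 'a where
  base: "x \<in> inv_closure x"
| linv: "y \<in> inv_closure x \<Longrightarrow> linv y \<in> inv_closure x"
| rinv: "y \<in> inv_closure x \<Longrightarrow> rinv y \<in> inv_closure x"


section \<open>Enhanced preorders and their layers\<close>

text \<open>The relation \<open>below\<close> is only meaningful on \<open>points\<close>.\<close>

record 'p enhanced_preorder =
  points :: "'p set"
  below :: "'p \<Rightarrow> 'p \<Rightarrow> bool"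
  pos :: "'p set"
  neg :: "'p set"

record 'p pointed_enhanced_preorder = "'p enhanced_preorder" +
  identity :: 'p

record 'p starred_enhanced_preorder = "'p pointed_enhanced_preorder" +
  star_map :: "'p \<Rightarrow> 'p"

definition monoidal_le :: "'a::residuated_lattice \<Rightarrow> 'a \<Rightarrow> bool" (infix "\<sqsubseteq>" 50) where
  "x \<sqsubseteq> y \<longleftrightarrow> x * y = x"

definition monoidal_preorder :: "'a::residuated_lattice starred_enhanced_preorder" where
  "monoidal_preorder =
     \<lparr>points = UNIV, below = (\<sqsubseteq>), pos = {x. 1 \<le> x}, neg = {x. x \<le> 1},
      identity = 1, star_map = star\<rparr>"

definition strictly_below :: "('p, 'b) enhanced_preorder_scheme \<Rightarrow> 'p \<Rightarrow> 'p \<Rightarrow> bool" where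
  "strictly_below P x y \<longleftrightarrow> below P x y \<and> \<not> below P y x"

definition same_layer :: "('p, 'b) enhanced_preorder_scheme \<Rightarrow> 'p \<Rightarrow> 'p \<Rightarrow> bool" where
  "same_layer P x y \<longleftrightarrow>
     {z \<in> points P. strictly_below P x z} = {z \<in> points P. strictly_below P y z} \<and>
     {z \<in> points P. strictly_below P z x} = {z \<in> points P. strictly_below P z y}"

text \<open>The order between the layers of \<open>x\<close> and \<open>y\<close>, expressed on representatives.\<close>

definition layer_le :: "('p, 'b) enhanced_preorder_scheme \<Rightarrow> 'p \<Rightarrow> 'p \<Rightarrow> bool" where
  "layer_le P x y \<longleftrightarrow> same_layer P x y \<or> below P x y"

definition layer_convex :: "('p, 'b) enhanced_preorder_scheme \<Rightarrow> 'p set \<Rightarrow> bool" where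
  "layer_convex P Q \<longleftrightarrow>
     Q \<subseteq> points P \<and>
     (\<forall>q1\<in>Q. \<forall>q2\<in>Q. \<forall>p\<in>points P. layer_le P q1 p \<and> layer_le P p q2 \<longrightarrow> p \<in> Q)"


section \<open>Vertical crowns\<close>

definition one_L :: "unit enhanced_preorder" where
  "one_L = \<lparr>points = UNIV, below = (\<lambda>_ _. True), pos = UNIV, neg = {}\<rparr>"

definition one_R :: "unit enhanced_preorder" where
  "one_R = \<lparr>points = UNIV, below = (\<lambda>_ _. True), pos = {}, neg = UNIV\<rparr>"

datatype two = pt_a | pt_b

definition two_L :: "two enhanced_preorder" where
  "two_L = \<lparr>points = UNIV, below = (\<lambda>_ _. True), pos = {pt_a}, neg = {pt_b}\<rparr>"

definition two_R :: "two enhanced_preorder" where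
  "two_R = \<lparr>points = UNIV, below = (=), pos = {pt_a}, neg = {pt_b}\<rparr>"

text \<open>The strict order \<open>lt\<close> of the index chain \<open>I\<close> is an explicit argument, so that the
  order dual of an index chain can be used.\<close>

definition ordinal_sum ::
  "'i set \<Rightarrow> ('i \<Rightarrow> 'i \<Rightarrow> bool) \<Rightarrow> ('i \<Rightarrow> 'p enhanced_preorder) \<Rightarrow> ('i \<times> 'p) enhanced_preorder" where
  "ordinal_sum I lt P =
     \<lparr>points = (SIGMA i:I. points (P i)),
      below = (\<lambda>(i, x) (j, y). lt i j \<or> i = j \<and> below (P i) x y),
      pos = (SIGMA i:I. pos (P i)),
      neg = (SIGMA i:I. neg (P i))\<rparr>"

definition oplus ::
  "'p enhanced_preorder \<Rightarrow> 'q enhanced_preorder \<Rightarrow> ('p + 'q) enhanced_preorder"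
  (infixl "\<oplus>" 65) where
  "P \<oplus> Q =
     \<lparr>points = points P <+> points Q,
      below = (\<lambda>u v. case (u, v) of
          (Inl x, Inl y) \<Rightarrow> below P x y
        | (Inl x, Inr y) \<Rightarrow> True
        | (Inr x, Inl y) \<Rightarrow> False
        | (Inr x, Inr y) \<Rightarrow> below Q x y),
      pos = pos P <+> pos Q,
      neg = neg P <+> neg Q\<rparr>"

text \<open>Declares the topmost summand \<open>one_L\<close> of a sum \<open>P \<oplus> one_L\<close> to be the identity
  element and adds it to the negative part.\<close>

definition top_identity :: "('p + unit) enhanced_preorder \<Rightarrow> ('p + unit) pointed_enhanced_preorder" where
  "top_identity P =
     \<lparr>points = points P, below = below P, pos = pos P, neg = insert (Inr ()) (neg P),
      identity = Inr ()\<rparr>"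

definition two_LR :: "'i set \<Rightarrow> 'i \<Rightarrow> two enhanced_preorder" where
  "two_LR L i = (if i \<in> L then two_L else two_R)"

definition crown_a where
  "crown_a (L :: int set) = top_identity (ordinal_sum UNIV (<) (two_LR L) \<oplus> one_L)"

definition crown_b where
  "crown_b (L :: nat set) = top_identity (one_R \<oplus> ordinal_sum UNIV (<) (two_LR L) \<oplus> one_L)"

definition crown_c where
  "crown_c (L :: nat set) = top_identity (ordinal_sum UNIV (>) (two_LR L) \<oplus> one_L \<oplus> one_L)"

definition crown_d where
  "crown_d (n :: nat) (L :: nat set) =
     top_identity (one_R \<oplus> ordinal_sum {1..n} (<) (two_LR L) \<oplus> one_L \<oplus> one_L)"

definition isomorphic ::
  "('p, 'b) pointed_enhanced_preorder_scheme \<Rightarrow> ('q, 'c) pointed_enhanced_preorder_scheme \<Rightarrow> bool" where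
  "isomorphic P Q \<longleftrightarrow>
     (\<exists>f. bij_betw f (points P) (points Q) \<and>
          (\<forall>x\<in>points P. \<forall>y\<in>points P. below P x y \<longleftrightarrow> below Q (f x) (f y)) \<and>
          (\<forall>x\<in>points P. x \<in> pos P \<longleftrightarrow> f x \<in> pos Q) \<and>
          (\<forall>x\<in>points P. x \<in> neg P \<longleftrightarrow> f x \<in> neg Q) \<and>
          f (identity P) = identity Q)"

text \<open>The star operation is part of \<open>monoidal_preorder\<close> but plays no role in \<open>isomorphic\<close>:
  vertical crowns carry no such operation.\<close>

definition crownian :: "'a::idempotent_residuated_chain itself \<Rightarrow> bool" where
  "crownian _ \<longleftrightarrow>
     (let A = monoidal_preorder :: 'a starred_enhanced_preorder in
        (\<exists>L. isomorphic A (crown_a L)) \<or>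
        (\<exists>L. isomorphic A (crown_b L)) \<or>
        (\<exists>L. isomorphic A (crown_c L)) \<or>
        (\<exists>n. \<exists>L\<subseteq>{1..n}. isomorphic A (crown_d n L)))"

end

theory Submission
  imports Defs
begin

text \<open>In an idempotent residuated chain \<open>x * y\<close> is always \<open>x\<close> or \<open>y\<close>, so the strict part of the
  monoidal preorder is a strict weak order, each rank of which contains at most one positive and
  one negative element; two distinct elements of a rank are obtained from each other by \<open>linv\<close> or
  \<open>rinv\<close>. If \<open>star\<close> is involutive, it moves a negative element to the rank immediately above and a
  positive one to the rank immediately below. Hence \<open>linv\<close> and \<open>rinv\<close> never skip a rank, which is
  (1), and the non-identity elements of a one-generated chain can be ranked by integers, the
  positive ranks being the negative ones shifted by one. The latter form an interval, and the
  four kinds of nonempty intervals of integers yield the four kinds of crowns. Conversely, such a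
  ranking determines \<open>star\<close>, which is therefore involutive, and stepping from rank to rank shows
  that any element other than \<open>1\<close> generates the chain.\<close>

section \<open>Idempotent residuated chains\<close>

lemma mult_left_mono_rl:
  fixes x y z :: "'a::residuated_lattice"
  assumes "x \<le> y"
  shows "z * x \<le> z * y"
  by (meson assms order_refl order_trans under_iff)

lemma mult_right_mono_rl:
  fixes x y z :: "'a::residuated_lattice"
  assumes "x \<le> y"
  shows "x * z \<le> y * z"
  by (meson assms order_refl order_trans over_iff)

text \<open>For equal signs the product is squeezed against \<open>max x y\<close> or
  \<open>min x y\<close>, using idempotence. For opposite signs it lies between the factors, and
  with \<open>p = x * y\<close> the identities \<open>x * p = p = p * y\<close> let the sign of
  \<open>p\<close> decide which factor it equals: for instance, if \<open>x \<le> 1 \<le> y\<close>,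
  then \<open>p \<le> 1\<close> gives \<open>p = x * p \<le> x\<close>, while
  \<open>1 \<le> p\<close> gives \<open>y \<le> p * y = p\<close>.\<close>

lemma mult_conservative:
  fixes x y :: "'a::idempotent_residuated_chain"
  shows "x * y = x \<or> x * y = y"
proof -
  have *: "x * (x * y) = x * y" "(x * y) * y = x * y"
    by (simp_all add: mult.assoc[symmetric] mult_idem) (simp add: mult.assoc mult_idem)
  consider "1 \<le> x" "1 \<le> y" | "x \<le> 1" "y \<le> 1" | "x \<le> 1" "1 \<le> y" | "1 \<le> x" "y \<le> 1"
    using linear by blast
  then show ?thesis
  proof cases
    case 1
    then have "x \<le> x * y" "y \<le> x * y"
      using mult_left_mono_rl[of 1 y x] mult_right_mono_rl[of 1 x y] by simp_all
    moreover have "x * y \<le> max x y"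
      using mult_left_mono_rl[of y "max x y" x] mult_right_mono_rl[of x "max x y" "max x y"]
      by (metis max.cobounded1 max.cobounded2 mult_idem order_trans)
    ultimately show ?thesis by (metis antisym max_def)
  next
    case 2
    then have "x * y \<le> x" "x * y \<le> y"
      using mult_left_mono_rl[of y 1 x] mult_right_mono_rl[of x 1 y] by simp_all
    moreover have "min x y \<le> x * y"
      using mult_left_mono_rl[of "min x y" y x] mult_right_mono_rl[of "min x y" x "min x y"]
      by (metis min.cobounded1 min.cobounded2 mult_idem order_trans)
    ultimately show ?thesis by (metis antisym min_def)
  next
    case 3
    then have "x \<le> x * y" "x * y \<le> y"
      using mult_left_mono_rl[of 1 y x] mult_right_mono_rl[of x 1 y] by simp_all
    moreover have "x * y \<le> x \<or> y \<le> x * y"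
      using * mult_left_mono_rl[of "x * y" 1 x] mult_right_mono_rl[of 1 "x * y" y] linear[of "x * y" 1]
      by auto
    ultimately show ?thesis by auto
  next
    case 4
    then have "x * y \<le> x" "y \<le> x * y"
      using mult_left_mono_rl[of y 1 x] mult_right_mono_rl[of 1 x y] by simp_all
    moreover have "x \<le> x * y \<or> x * y \<le> y"
      using * mult_left_mono_rl[of 1 "x * y" x] mult_right_mono_rl[of "x * y" 1 y] linear[of "x * y" 1]
      by auto
    ultimately show ?thesis by auto
  qed
qed

lemma mult_pos_pos:
  fixes x y :: "'a::idempotent_residuated_chain"
  assumes "1 \<le> x" "1 \<le> y"
  shows "x * y = max x y"
  using mult_conservative[of x y] mult_left_mono_rl[of 1 y x] mult_right_mono_rl[of 1 x y] assms
  by (auto simp: max_def)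

lemma mult_neg_neg:
  fixes x y :: "'a::idempotent_residuated_chain"
  assumes "x \<le> 1" "y \<le> 1"
  shows "x * y = min x y"
  using mult_conservative[of x y] mult_left_mono_rl[of y 1 x] mult_right_mono_rl[of x 1 y] assms
  by (auto simp: min_def)

section \<open>The two inverses and their meet\<close>

lemma le_rinv_iff: "y \<le> rinv x \<longleftrightarrow> x * y \<le> 1"
  by (simp add: rinv_def under_iff)

lemma le_linv_iff: "y \<le> linv x \<longleftrightarrow> y * x \<le> 1"
  by (simp add: linv_def over_iff)

lemma le_star_iff: "y \<le> star x \<longleftrightarrow> x * y \<le> 1 \<and> y * x \<le> 1"
  by (auto simp: star_def le_rinv_iff le_linv_iff)

lemma star_cases:
  fixes x :: "'a::idempotent_residuated_chain"
  shows "star x = linv x \<and> linv x \<le> rinv x \<or> star x = rinv x \<and> rinv x \<le> linv x"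
  unfolding star_def using linear[of "linv x" "rinv x"] by (auto simp: inf_absorb1 inf_absorb2)

lemma star_antimono:
  fixes x y :: "'a::residuated_lattice"
  assumes "x \<le> y"
  shows "star y \<le> star x"
proof -
  have "y * star y \<le> 1" "star y * y \<le> 1" using le_star_iff[of "star y" y] by auto
  then show ?thesis
    using mult_left_mono_rl[OF assms, of "star y"] mult_right_mono_rl[OF assms, of "star y"]
    by (auto simp: le_star_iff intro: order_trans)
qed

lemma star_one: "star (1 :: 'a::residuated_lattice) = 1"
  by (metis le_star_iff antisym mult_1_left mult_1_right order_refl)

lemma inv_neg:
  fixes b :: "'a::residuated_lattice"
  assumes "b \<le> 1"
  shows "1 \<le> linv b" "1 \<le> rinv b" "1 \<le> star b"
  using assms by (simp_all add: le_linv_iff le_rinv_iff le_star_iff)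

lemma inv_pos:
  fixes a :: "'a::idempotent_residuated_chain"
  assumes "1 < a"
  shows "linv a < 1" "rinv a < 1" "star a < 1"
proof -
  show "linv a < 1" "rinv a < 1"
    using assms le_linv_iff[of 1 a] le_rinv_iff[of 1 a] by (auto simp: not_le)
  then show "star a < 1" using star_cases[of a] by auto
qed


section \<open>The strict monoidal preorder\<close>

definition below_strict :: "'a::residuated_lattice \<Rightarrow> 'a \<Rightarrow> bool" (infix "\<sqsubset>" 50) where
  "x \<sqsubset> y \<longleftrightarrow> x \<sqsubseteq> y \<and> \<not> y \<sqsubseteq> x"

text \<open>On chains this is an equivalence relation whose classes are the layers, so the sets of
  strict bounds in \<open>same_layer\<close> need not be handled.\<close>

abbreviation same_rank :: "'a::residuated_lattice \<Rightarrow> 'a \<Rightarrow> bool" (infix "\<asymp>" 50) where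
  "x \<asymp> y \<equiv> \<not> x \<sqsubset> y \<and> \<not> y \<sqsubset> x"

lemma strictly_below_monoidal_preorder: "strictly_below monoidal_preorder = (\<sqsubset>)"
  by (auto simp: strictly_below_def monoidal_preorder_def below_strict_def fun_eq_iff)

text \<open>If \<open>y * x\<close> is not \<open>y\<close>, conservativity makes it
  \<open>x\<close>. Strict comparability thus forces commutation, and distinct elements of the same
  rank are exactly those that do not commute.\<close>

lemma below_strict_iff:
  fixes x y :: "'a::idempotent_residuated_chain"
  shows "x \<sqsubset> y \<longleftrightarrow> x \<noteq> y \<and> x * y = x \<and> y * x = x"
  using mult_conservative[of y x] by (auto simp: below_strict_def monoidal_le_def mult_idem)

lemma below_strict_irrefl: "\<not> x \<sqsubset> x"
  by (simp add: below_strict_def)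

lemma below_strict_trans:
  fixes x y z :: "'a::residuated_lattice"
  assumes "x \<sqsubset> y" "y \<sqsubset> z"
  shows "x \<sqsubset> z"
  using assms unfolding below_strict_def monoidal_le_def by (metis mult.assoc)

text \<open>The crucial case is that of \<open>y\<close> incomparable to both \<open>x\<close> and \<open>z\<close>: then
  \<open>z = y * z = x * y * z = x * z = x\<close>.\<close>

lemma below_strict_negatrans:
  fixes x y z :: "'a::idempotent_residuated_chain"
  assumes "x \<sqsubset> z"
  shows "x \<sqsubset> y \<or> y \<sqsubset> z"
proof (rule ccontr)
  assume n: "\<not> ?thesis"
  then have "\<not> y \<sqsubset> x" "\<not> z \<sqsubset> y" "x \<noteq> y" "y \<noteq> z"
    using assms below_strict_trans by blast+
  with n have "x * y = x \<and> y * x = y \<or> x * y = y \<and> y * x = x"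
    "y * z = y \<and> z * y = z \<or> y * z = z \<and> z * y = y"
    unfolding below_strict_iff using mult_conservative by metis+
  with assms show False unfolding below_strict_iff by (metis mult.assoc)
qed

lemma same_rank_trans:
  fixes x y z :: "'a::idempotent_residuated_chain"
  assumes "x \<asymp> y" "y \<asymp> z"
  shows "x \<asymp> z"
  using assms below_strict_negatrans by blast

lemma below_strict_one: "x \<sqsubset> 1 \<longleftrightarrow> x \<noteq> 1" "\<not> 1 \<sqsubset> x"
  by (auto simp: below_strict_def monoidal_le_def)

lemma below_strict_pos_pos:
  fixes x y :: "'a::idempotent_residuated_chain"
  assumes "1 \<le> x" "1 \<le> y"
  shows "x \<sqsubset> y \<longleftrightarrow> y < x"
  using assms by (auto simp: below_strict_iff mult_pos_pos max_def)

lemma below_strict_neg_neg: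
  fixes x y :: "'a::idempotent_residuated_chain"
  assumes "x \<le> 1" "y \<le> 1"
  shows "x \<sqsubset> y \<longleftrightarrow> x < y"
  using assms by (auto simp: below_strict_iff mult_neg_neg min_def)

text \<open>On the negative cone \<open>\<sqsubset>\<close> is the strict linear order, on the
  positive cone its converse, so two distinct elements of one cone are always strictly
  comparable.\<close>

lemma same_rank_same_sign:
  fixes x y :: "'a::idempotent_residuated_chain"
  assumes "x \<asymp> y" "1 \<le> x \<and> 1 \<le> y \<or> x \<le> 1 \<and> y \<le> 1"
  shows "x = y"
  using assms below_strict_pos_pos below_strict_neg_neg by (metis linorder_neqE)

lemma same_rank_if_noncommuting:
  fixes x y :: "'a::idempotent_residuated_chain"
  assumes "x * y \<noteq> y * x"
  shows "x \<asymp> y"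
  using assms by (auto simp: below_strict_iff)

lemma noncommuting_if_same_rank:
  fixes x y :: "'a::idempotent_residuated_chain"
  assumes "x \<asymp> y" "x \<noteq> y"
  shows "x * y \<noteq> y * x"
  using assms mult_conservative[of x y] by (auto simp: below_strict_iff)

text \<open>Since \<open>b < 1 < a\<close>, a product of the two equals \<open>b\<close> as soon as
  it is at most \<open>1\<close>. Hence \<open>star b\<close> bounds exactly the positive elements
  strictly above \<open>b\<close>, and \<open>star a\<close> the negative ones strictly below
  \<open>a\<close>.\<close>

lemma neg_below_pos_iff:
  fixes a b :: "'a::idempotent_residuated_chain"
  assumes "b < 1" "1 < a"
  shows "b \<sqsubset> a \<longleftrightarrow> a \<le> star b" "b \<sqsubset> a \<longleftrightarrow> b \<le> star a"
  unfolding le_star_iff below_strict_iff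
  using assms mult_conservative[of a b] mult_conservative[of b a] by auto

lemma below_star_neg:
  fixes b :: "'a::idempotent_residuated_chain"
  assumes "b < 1"
  shows "b \<sqsubset> star b"
  using assms inv_neg[of b] neg_below_pos_iff(1)[of b "star b"] below_strict_one
  by (metis order.strict_iff_order order_refl)

lemma star_pos_below:
  fixes a :: "'a::idempotent_residuated_chain"
  assumes "1 < a"
  shows "star a \<sqsubset> a"
  using assms inv_pos[of a] neg_below_pos_iff(2)[of "star a" a] by simp

text \<open>Outside the rank of \<open>x\<close>, \<open>linv x\<close> commutes with
  \<open>x\<close>, so the one-sided inequality defining it becomes two-sided and puts it below
  \<open>star x\<close>.\<close>

lemma linv_cases:
  fixes x :: "'a::idempotent_residuated_chain"
  shows "linv x = star x \<or> linv x \<asymp> x"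
proof (rule disjCI)
  assume "\<not> linv x \<asymp> x"
  then have "linv x * x = x * linv x" using same_rank_if_noncommuting by blast
  then have "linv x \<le> star x" using le_linv_iff[of "linv x" x] by (simp add: le_star_iff)
  then show "linv x = star x" by (simp add: antisym star_def)
qed

lemma rinv_cases:
  fixes x :: "'a::idempotent_residuated_chain"
  shows "rinv x = star x \<or> rinv x \<asymp> x"
proof (rule disjCI)
  assume "\<not> rinv x \<asymp> x"
  then have "rinv x * x = x * rinv x" using same_rank_if_noncommuting by blast
  then have "rinv x \<le> star x" using le_rinv_iff[of "rinv x" x] by (simp add: le_star_iff)
  then show "rinv x = star x" by (simp add: antisym star_def)
qed

text \<open>The elements do not commute and have opposite signs, so exactly one of their two
  products is at most \<open>1\<close>. Thus \<open>x\<close> separates \<open>linv y\<close> from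
  \<open>rinv y\<close>; the one that differs from \<open>star y\<close> has the rank of
  \<open>y\<close> and the sign of \<open>x\<close>, hence is \<open>x\<close>.\<close>

lemma same_rank_partner:
  fixes x y :: "'a::idempotent_residuated_chain"
  assumes "x \<asymp> y" "x \<noteq> y" "y \<noteq> 1"
  shows "x = linv y \<or> x = rinv y"
proof -
  have nc: "x * y \<noteq> y * x" using assms noncommuting_if_same_rank by blast
  have opp: "x < 1 \<and> 1 < y \<or> y < 1 \<and> 1 < x"
    using same_rank_same_sign[OF assms(1)] assms(2,3) below_strict_one[of x] below_strict_one[of y]
    by (metis assms(1) le_less linear neqE)
  \<comment> \<open>To be applied with \<open>z\<close> one of the two inverses of
    \<open>y\<close>.\<close>
  have *: "z = x" if "z \<asymp> y" "y < 1 \<longrightarrow> 1 \<le> z" "1 < y \<longrightarrow> z < 1" for z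
    using same_rank_same_sign[of z x] same_rank_trans[OF that(1), of x] assms(1) opp that(2,3)
    by (meson less_imp_le not_less_iff_gr_or_eq)
  have signs: "y < 1 \<longrightarrow> 1 \<le> linv y" "1 < y \<longrightarrow> linv y < 1"
    "y < 1 \<longrightarrow> 1 \<le> rinv y" "1 < y \<longrightarrow> rinv y < 1"
    using inv_neg[of y] inv_pos[of y] by auto
  have "x * y \<le> 1 \<and> \<not> y * x \<le> 1 \<or> y * x \<le> 1 \<and> \<not> x * y \<le> 1"
    using nc opp mult_conservative[of x y] mult_conservative[of y x] by auto
  then have "\<not> linv y \<le> rinv y \<or> \<not> rinv y \<le> linv y"
    by (metis le_linv_iff le_rinv_iff order_trans)
  then have "linv y \<noteq> star y \<or> rinv y \<noteq> star y" by auto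
  then have "linv y \<asymp> y \<or> rinv y \<asymp> y" using linv_cases rinv_cases by blast
  then show ?thesis using * signs by blast
qed

lemma same_rank_mem_inv_closure:
  fixes x y z :: "'a::idempotent_residuated_chain"
  assumes "y \<in> inv_closure x" "z \<asymp> y" "y \<noteq> 1"
  shows "z \<in> inv_closure x"
  using assms same_rank_partner[of z y] inv_closure.linv inv_closure.rinv by (cases "z = y") auto

lemma star_mem_inv_closure:
  fixes x y :: "'a::idempotent_residuated_chain"
  assumes "y \<in> inv_closure x"
  shows "star y \<in> inv_closure x"
  using assms star_cases[of y] inv_closure.linv inv_closure.rinv by metis


section \<open>Involutive chains\<close>

lemma star_neg_gt_one:
  fixes b :: "'a::idempotent_residuated_chain"
  assumes "star_involutive TYPE('a)" "b < 1"
  shows "1 < star b"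
  using assms inv_neg[of b] star_one by (metis less_le star_involutive_def)

text \<open>A negative \<open>c\<close> below \<open>star b\<close> would give
  \<open>star b \<le> star c\<close>, hence \<open>c \<le> b\<close> by antitonicity and
  involutivity. A positive \<open>c\<close> above \<open>b\<close> satisfies
  \<open>c \<le> star b\<close>, and the preorder reverses the order of positive elements.\<close>

lemma star_covers:
  fixes b c :: "'a::idempotent_residuated_chain"
  assumes inv: "star_involutive TYPE('a)" and "b < 1" "b \<sqsubset> c"
  shows "\<not> c \<sqsubset> star b"
proof
  assume c: "c \<sqsubset> star b"
  then have "c \<noteq> 1" using below_strict_one by blast
  have pos: "1 < star b" using assms star_neg_gt_one by blast
  show False
  proof (cases "c < 1")
    case True
    then have "star b \<le> star c" using neg_below_pos_iff(1) pos c by blast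
    then have "star (star c) \<le> star (star b)" by (rule star_antimono)
    then have "c \<le> b" using inv by (simp add: star_involutive_def)
    then show False using assms True below_strict_neg_neg[of b c] by simp
  next
    case False
    then have "1 < c" using \<open>c \<noteq> 1\<close> by simp
    then show False
      using c assms pos neg_below_pos_iff(1)[of b c] below_strict_pos_pos[of c "star b"] by simp
  qed
qed

lemma star_covered:
  fixes a c :: "'a::idempotent_residuated_chain"
  assumes inv: "star_involutive TYPE('a)" and "1 < a" "star a \<sqsubset> c"
  shows "\<not> c \<sqsubset> a"
  using star_covers[OF inv, of "star a" c] inv_pos(3)[OF assms(2)] assms
  by (simp add: star_involutive_def)

text \<open>The rank of \<open>1\<close> is a singleton, so a step within a rank cannot lead to
  \<open>1\<close>; and \<open>star y = 1\<close> would give \<open>y = star 1 = 1\<close>.\<close>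

lemma inv_closure_not_one:
  fixes x y :: "'a::idempotent_residuated_chain"
  assumes "star_involutive TYPE('a)" "x \<noteq> 1" "y \<in> inv_closure x"
  shows "y \<noteq> 1"
  using assms(3)
proof induction
  case base then show ?case using assms by simp
next
  case (linv y)
  then show ?case using linv_cases[of y] below_strict_one star_one assms(1)
    by (metis star_involutive_def)
next
  case (rinv y)
  then show ?case using rinv_cases[of y] below_strict_one star_one assms(1)
    by (metis star_involutive_def)
qed

text \<open>Every generation step either stays within a rank or moves to an adjacent one, hence
  cannot skip a rank missed by the closure.\<close>

lemma inv_closure_convex:
  fixes x p q1 q2 :: "'a::idempotent_residuated_chain"
  assumes inv: "star_involutive TYPE('a)" and x: "x \<noteq> 1"
    and q: "q1 \<in> inv_closure x" "q2 \<in> inv_closure x"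
    and p: "\<not> p \<sqsubset> q1" "\<not> q2 \<sqsubset> p"
  shows "p \<in> inv_closure x"
proof (rule ccontr)
  assume notin: "p \<notin> inv_closure x"
  note not_one = inv_closure_not_one[OF inv x]
  have related: "y \<sqsubset> p \<or> p \<sqsubset> y" if "y \<in> inv_closure x" for y
    using that notin same_rank_mem_inv_closure[OF that, of p] not_one[OF that] by blast
  \<comment> \<open>The ranks of \<open>y\<close> and \<open>star y\<close> are adjacent and
    \<open>p\<close> lies in neither, so both elements are on the same side of
    \<open>p\<close>.\<close>
  have step: "(star y \<sqsubset> p \<longleftrightarrow> y \<sqsubset> p)" if y: "y \<in> inv_closure x" for y
  proof -
    have sy: "star y \<in> inv_closure x" by (rule star_mem_inv_closure[OF y])
    consider "y < 1" | "1 < y" using not_one[OF y] by fastforce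
    then show ?thesis
    proof cases
      case 1
      then show ?thesis
        using below_star_neg[of y] star_covers[OF inv, of y p] related[OF y] related[OF sy]
          below_strict_trans below_strict_irrefl by blast
    next
      case 2
      then show ?thesis
        using star_pos_below[of y] star_covered[OF inv, of y p] related[OF y] related[OF sy]
          below_strict_trans below_strict_irrefl by blast
    qed
  qed
  have same: "z \<sqsubset> p \<longleftrightarrow> y \<sqsubset> p" if "z \<asymp> y" for y z
    using that below_strict_negatrans by blast
  have "y \<in> inv_closure x \<and> (y \<sqsubset> p \<longleftrightarrow> x \<sqsubset> p)" if "y \<in> inv_closure x" for y
    using that
  proof induction
    case base show ?case by (simp add: inv_closure.base)
  next
    case (linv y)
    then show ?case using linv_cases[of y] step[of y] same[of "linv y" y] inv_closure.linv[of y x] by auto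
  next
    case (rinv y)
    then show ?case using rinv_cases[of y] step[of y] same[of "rinv y" y] inv_closure.rinv[of y x] by auto
  qed
  then have "q1 \<sqsubset> p \<longleftrightarrow> q2 \<sqsubset> p" using q by blast
  then show False using p related q by blast
qed

lemma layer_convex_inv_closure:
  fixes x :: "'a::idempotent_residuated_chain"
  assumes "star_involutive TYPE('a)" "x \<noteq> 1"
  shows "layer_convex monoidal_preorder (inv_closure x)"
proof -
  \<comment> \<open>This consequence of the layer order is all that
    \<open>inv_closure_convex\<close> requires.\<close>
  have not_above: "\<not> q \<sqsubset> p" if "layer_le monoidal_preorder p q" for p q :: 'a
    using that below_strict_irrefl unfolding layer_le_def same_layer_def strictly_below_monoidal_preorder
    by (auto simp: monoidal_preorder_def below_strict_def)
  show ?thesis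
    unfolding layer_convex_def
  proof (intro conjI ballI impI)
    show "inv_closure x \<subseteq> points monoidal_preorder" by (simp add: monoidal_preorder_def)
  next
    fix q1 q2 p
    assume "q1 \<in> inv_closure x" "q2 \<in> inv_closure x"
      and "layer_le monoidal_preorder q1 p \<and> layer_le monoidal_preorder p q2"
    then show "p \<in> inv_closure x" by (meson inv_closure_convex[OF assms] not_above)
  qed
qed


section \<open>Generated subalgebras\<close>

text \<open>Read as conditions on \<open>z\<close>, these express the down-set of a residual by the
  down-sets of an inverse of \<open>x\<close> and of \<open>y\<close>: their union if
  \<open>x \<le> y\<close>, their intersection otherwise. The residual is therefore the maximum or
  minimum of that inverse and \<open>y\<close>.\<close>

lemma mult_le_iff:
  fixes x y z :: "'a::idempotent_residuated_chain"
  shows "x * z \<le> y \<longleftrightarrow> (if x \<le> y then x * z \<le> 1 \<or> z \<le> y else x * z \<le> 1 \<and> z \<le> y)"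
    and "z * x \<le> y \<longleftrightarrow> (if x \<le> y then z * x \<le> 1 \<or> z \<le> y else z * x \<le> 1 \<and> z \<le> y)"
proof -
  consider "1 \<le> x" "1 \<le> z" | "x \<le> 1" "z \<le> 1" | "x < 1" "1 < z" | "1 < x" "z < 1"
    by (meson le_less_linear less_imp_le)
  then have "(x * z \<le> y \<longleftrightarrow> (if x \<le> y then x * z \<le> 1 \<or> z \<le> y else x * z \<le> 1 \<and> z \<le> y)) \<and>
    (z * x \<le> y \<longleftrightarrow> (if x \<le> y then z * x \<le> 1 \<or> z \<le> y else z * x \<le> 1 \<and> z \<le> y))"
  proof cases
    case 1 then show ?thesis by (auto simp: mult_pos_pos)
  next
    case 2 then show ?thesis by (auto simp: mult_neg_neg min_le_iff_disj)
  next
    case 3 then show ?thesis using mult_conservative[of x z] mult_conservative[of z x] by auto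
  next
    case 4 then show ?thesis using mult_conservative[of x z] mult_conservative[of z x] by auto
  qed
  then show "x * z \<le> y \<longleftrightarrow> (if x \<le> y then x * z \<le> 1 \<or> z \<le> y else x * z \<le> 1 \<and> z \<le> y)"
    and "z * x \<le> y \<longleftrightarrow> (if x \<le> y then z * x \<le> 1 \<or> z \<le> y else z * x \<le> 1 \<and> z \<le> y)"
    by blast+
qed

lemma under_cases:
  fixes x y :: "'a::idempotent_residuated_chain"
  shows "x \<setminus> y = rinv x \<or> x \<setminus> y = y"
proof -
  have "z \<le> x \<setminus> y \<longleftrightarrow> (if x \<le> y then z \<le> rinv x \<or> z \<le> y else z \<le> rinv x \<and> z \<le> y)" for z
    using mult_le_iff(1)[of x z y] by (simp add: under_iff le_rinv_iff)
  then show ?thesis by (metis antisym linear order_refl)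
qed

lemma over_cases:
  fixes x y :: "'a::idempotent_residuated_chain"
  shows "y \<sslash> x = linv x \<or> y \<sslash> x = y"
proof -
  have "z \<le> y \<sslash> x \<longleftrightarrow> (if x \<le> y then z \<le> linv x \<or> z \<le> y else z \<le> linv x \<and> z \<le> y)" for z
    using mult_le_iff(2)[of z x y] by (simp add: over_iff le_linv_iff)
  then show ?thesis by (metis antisym linear order_refl)
qed

text \<open>On a chain the lattice operations and the product return one of their arguments, and a
  residual returns its numerator or an inverse of its denominator.\<close>

lemma subalgebra_gen_subset:
  fixes x :: "'a::idempotent_residuated_chain"
  shows "subalgebra_gen {x} \<subseteq> insert 1 (inv_closure x)"
proof
  have inv_one: "linv 1 = (1::'a)" "rinv 1 = (1::'a)"
    by (metis le_linv_iff antisym mult_1_left mult_1_right order_refl)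
       (metis le_rinv_iff antisym mult_1_left mult_1_right order_refl)
  fix y assume "y \<in> subalgebra_gen {x}"
  then show "y \<in> insert 1 (inv_closure x)"
  proof induction
    case (inf y z) then show ?case using linear[of y z] by (auto simp: inf_absorb1 inf_absorb2)
  next
    case (sup y z) then show ?case using linear[of y z] by (auto simp: sup_absorb1 sup_absorb2)
  next
    case (mult y z) then show ?case using mult_conservative[of y z] by metis
  next
    case (under y z) then show ?case using under_cases[of y z] inv_one inv_closure.rinv[of y x] by auto
  next
    case (over y z) then show ?case using over_cases[of y z] inv_one inv_closure.linv[of z x] by auto
  qed (auto intro: inv_closure.base)
qed

lemma inv_closure_subset_subalgebra_gen: "inv_closure x \<subseteq> subalgebra_gen {x}"
proof
  fix y assume "y \<in> inv_closure x"
  then show "y \<in> subalgebra_gen {x}"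
    by induction (auto simp: linv_def rinv_def intro: subalgebra_gen.intros)
qed


section \<open>Ranked enhanced preorders\<close>

text \<open>A uniform description of the vertical crowns: \<open>N\<close> is the set of ranks of the negative
  elements, the ranks of the positive ones are those of \<open>N\<close> shifted up by one, and \<open>L\<close> contains
  the ranks carrying a copy of \<open>two_L\<close>. The crowns (a)--(d) correspond to the four kinds of
  nonempty intervals \<open>N\<close> of integers.\<close>

definition ranked ::
  "('p, 'b) pointed_enhanced_preorder_scheme \<Rightarrow> ('p \<Rightarrow> int) \<Rightarrow> int set \<Rightarrow> int set \<Rightarrow> bool" where
  "ranked P r N L \<longleftrightarrow>
     pos P \<union> neg P = points P \<and> pos P \<inter> neg P = {identity P} \<and>
     (\<forall>u\<in>points P. below P u (identity P) \<and> (below P (identity P) u \<longleftrightarrow> u = identity P)) \<and>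
     bij_betw r (neg P - {identity P}) N \<and>
     bij_betw r (pos P - {identity P}) ((\<lambda>i. i + 1) ` N) \<and>
     (\<forall>u\<in>points P - {identity P}. \<forall>v\<in>points P - {identity P}. below P u v \<longleftrightarrow>
        r u < r v \<or> r u = r v \<and> (r u \<in> L \<or> (u \<in> pos P \<longleftrightarrow> v \<in> pos P)))"

lemma rankedD:
  assumes "ranked P r N L"
  shows "pos P \<union> neg P = points P" "pos P \<inter> neg P = {identity P}"
    and "u \<in> points P \<Longrightarrow> below P u (identity P)"
    and "u \<in> points P \<Longrightarrow> below P (identity P) u \<longleftrightarrow> u = identity P"
    and "bij_betw r (neg P - {identity P}) N"
    and "bij_betw r (pos P - {identity P}) ((\<lambda>i. i + 1) ` N)"
    and "u \<in> points P \<Longrightarrow> v \<in> points P \<Longrightarrow> u \<noteq> identity P \<Longrightarrow> v \<noteq> identity P \<Longrightarrow>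
      below P u v \<longleftrightarrow> r u < r v \<or> r u = r v \<and> (r u \<in> L \<or> (u \<in> pos P \<longleftrightarrow> v \<in> pos P))"
  using assms unfolding ranked_def by simp_all

lemma ranked_sign_cases:
  assumes "ranked P r N L" "u \<in> points P"
  obtains (identity) "u = identity P" "u \<in> pos P" "u \<in> neg P"
  | (neg) "u \<in> neg P - {identity P}" "u \<notin> pos P" "u \<noteq> identity P"
  | (pos) "u \<in> pos P - {identity P}" "u \<notin> neg P" "u \<noteq> identity P"
  using rankedD(1,2)[OF assms(1)] assms(2) by blast

text \<open>Sign and rank identify a non-identity element, and together with \<open>L\<close> they
  determine the preorder; so the bijection preserving both is an isomorphism.\<close>

lemma isomorphic_if_ranked:
  fixes P :: "('p, 'b) pointed_enhanced_preorder_scheme"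
    and Q :: "('q, 'c) pointed_enhanced_preorder_scheme"
  assumes P: "ranked P r N L" and Q: "ranked Q s N L"
  shows "isomorphic P Q"
proof -
  let ?i = "identity P" and ?j = "identity Q"
  define f where "f u = (if u = ?i then ?j
    else if u \<in> neg P then inv_into (neg Q - {?j}) s (r u)
    else inv_into (pos Q - {?j}) s (r u))" for u
  note bP = rankedD(5,6)[OF P] and bQ = rankedD(5,6)[OF Q]
  have ptsP: "points P = {?i} \<union> ((neg P - {?i}) \<union> (pos P - {?i}))"
    and disjP: "(neg P - {?i}) \<inter> (pos P - {?i}) = {}"
    using rankedD(1,2)[OF P] by blast+
  have ptsQ: "points Q = {?j} \<union> ((neg Q - {?j}) \<union> (pos Q - {?j}))"
    and disjQ: "(neg Q - {?j}) \<inter> (pos Q - {?j}) = {}"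
    using rankedD(1,2)[OF Q] by blast+
  have jQ: "?j \<in> pos Q" "?j \<in> neg Q" using rankedD(2)[OF Q] by blast+
  have fi: "f ?i = ?j" by (simp add: f_def)
  have fneg: "bij_betw f (neg P - {?i}) (neg Q - {?j})"
    using bij_betw_trans[OF bP(1) bij_betw_inv_into[OF bQ(1)]]
    by (rule bij_betw_cong[THEN iffD1, rotated]) (auto simp: f_def)
  have fpos: "bij_betw f (pos P - {?i}) (pos Q - {?j})"
    using bij_betw_trans[OF bP(2) bij_betw_inv_into[OF bQ(2)]]
    by (rule bij_betw_cong[THEN iffD1, rotated]) (use disjP in \<open>auto simp: f_def\<close>)
  have "bij_betw f ({?i} \<union> ((neg P - {?i}) \<union> (pos P - {?i}))) ({?j} \<union> ((neg Q - {?j}) \<union> (pos Q - {?j})))"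
    using fneg fpos fi disjQ by (intro bij_betw_combine) auto
  then have bij: "bij_betw f (points P) (points Q)" using ptsP ptsQ by simp
  have sf: "s (f u) = r u" and fj: "f u \<noteq> ?j"
    and neg_iff: "u \<in> neg P \<longleftrightarrow> f u \<in> neg Q" and pos_iff: "u \<in> pos P \<longleftrightarrow> f u \<in> pos Q"
    if "u \<in> points P" "u \<noteq> ?i" for u
  proof -
    have "s (f u) = r u \<and> f u \<noteq> ?j \<and> (u \<in> neg P \<longleftrightarrow> f u \<in> neg Q) \<and> (u \<in> pos P \<longleftrightarrow> f u \<in> pos Q)"
      using P that(1)
    proof (cases rule: ranked_sign_cases)
      case identity then show ?thesis using that by simp
    next
      case neg
      have "f u \<in> neg Q - {?j}" using fneg neg(1) by (rule bij_betwE[THEN bspec])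
      moreover have "r u \<in> s ` (neg Q - {?j})"
        using bij_betwE[OF bP(1), THEN bspec, OF neg(1)] bQ(1) by (simp add: bij_betw_def)
      then have "s (f u) = r u" using neg by (simp add: f_def f_inv_into_f)
      ultimately show ?thesis using neg disjQ by blast
    next
      case pos
      have "f u \<in> pos Q - {?j}" using fpos pos(1) by (rule bij_betwE[THEN bspec])
      moreover have "r u \<in> s ` (pos Q - {?j})"
        using bij_betwE[OF bP(2), THEN bspec, OF pos(1)] bQ(2) by (simp add: bij_betw_def)
      then have "s (f u) = r u" using pos by (simp add: f_def f_inv_into_f)
      ultimately show ?thesis using pos disjQ by blast
    qed
    then show "s (f u) = r u" "f u \<noteq> ?j" "u \<in> neg P \<longleftrightarrow> f u \<in> neg Q" "u \<in> pos P \<longleftrightarrow> f u \<in> pos Q"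
      by blast+
  qed
  have fmem: "f u \<in> points Q" if "u \<in> points P" for u using bij that by (rule bij_betwE[THEN bspec])
  have iP: "?i \<in> points P" "?i \<in> pos P" "?i \<in> neg P" using rankedD(1,2)[OF P] by blast+
  show ?thesis unfolding isomorphic_def
  proof (intro exI[of _ f] conjI ballI)
    fix u v assume uv: "u \<in> points P" "v \<in> points P"
    show "below P u v \<longleftrightarrow> below Q (f u) (f v)"
    proof (cases "u = ?i \<or> v = ?i")
      case True
      then show ?thesis
        using rankedD(3,4)[OF P] rankedD(3,4)[OF Q] uv fi fj fmem by metis
    next
      case False
      then show ?thesis
        using rankedD(7)[OF P uv] rankedD(7)[OF Q fmem[OF uv(1)] fmem[OF uv(2)]] uv fj sf pos_iff by simp
    qed
  next
    fix u assume u: "u \<in> points P"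
    show "u \<in> pos P \<longleftrightarrow> f u \<in> pos Q" using pos_iff[OF u] iP jQ fi by (cases "u = ?i") auto
    show "u \<in> neg P \<longleftrightarrow> f u \<in> neg Q" using neg_iff[OF u] iP jQ fi by (cases "u = ?i") auto
  qed (fact bij fi)+
qed

text \<open>The rank function is pulled back along the isomorphism. The assumptions on
  \<open>P\<close> are stated because \<open>isomorphic\<close> speaks only about elements of
  \<open>points P\<close>.\<close>

lemma ranked_if_isomorphic:
  fixes P :: "('p, 'b) pointed_enhanced_preorder_scheme"
    and Q :: "('q, 'c) pointed_enhanced_preorder_scheme"
  assumes iso: "isomorphic P Q" and Q: "ranked Q s N L"
    and P: "pos P \<subseteq> points P" "neg P \<subseteq> points P" "identity P \<in> points P"
  shows "\<exists>r. ranked P r N L"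
proof -
  let ?i = "identity P" and ?j = "identity Q"
  obtain f where bij: "bij_betw f (points P) (points Q)"
    and bel: "\<And>x y. x \<in> points P \<Longrightarrow> y \<in> points P \<Longrightarrow> below P x y \<longleftrightarrow> below Q (f x) (f y)"
    and pos: "\<And>x. x \<in> points P \<Longrightarrow> x \<in> pos P \<longleftrightarrow> f x \<in> pos Q"
    and neg: "\<And>x. x \<in> points P \<Longrightarrow> x \<in> neg P \<longleftrightarrow> f x \<in> neg Q"
    and fi: "f ?i = ?j"
    using iso unfolding isomorphic_def by blast
  note ptsQ = rankedD(1,2)[OF Q]
  have inj: "inj_on f (points P)" and surj: "f ` points P = points Q"
    using bij by (auto simp: bij_betw_def)
  have fj: "f u = ?j \<longleftrightarrow> u = ?i" if "u \<in> points P" for u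
    using inj_on_eq_iff[OF inj that P(3)] fi by simp
  have fmem: "f u \<in> points Q" if "u \<in> points P" for u using bij that by (rule bij_betwE[THEN bspec])
  have restrict: "bij_betw f (X - {?i}) (Y - {?j})"
    if X: "X \<subseteq> points P" and Y: "Y \<subseteq> points Q" and XY: "\<And>u. u \<in> points P \<Longrightarrow> u \<in> X \<longleftrightarrow> f u \<in> Y" for X Y
  proof (rule bij_betw_imageI)
    show "inj_on f (X - {?i})" using inj by (rule inj_on_subset) (use X in blast)
    show "f ` (X - {?i}) = Y - {?j}"
    proof (intro set_eqI iffI)
      fix v assume "v \<in> f ` (X - {?i})"
      then obtain u where u: "u \<in> X" "u \<noteq> ?i" "v = f u" by blast
      then have "u \<in> points P" using X by blast
      then show "v \<in> Y - {?j}" using u XY[of u] fj[of u] by simp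
    next
      fix v assume v: "v \<in> Y - {?j}"
      then have "v \<in> f ` points P" using Y surj by blast
      then obtain u where u: "u \<in> points P" "v = f u" by blast
      then have "u \<in> X - {?i}" using v XY[of u] fi by auto
      then show "v \<in> f ` (X - {?i})" using u by blast
    qed
  qed
  have sub: "neg Q \<subseteq> points Q" "pos Q \<subseteq> points Q" using ptsQ(1) by blast+
  have sign: "pos P \<union> neg P = points P" "pos P \<inter> neg P = {?i}"
  proof -
    show "pos P \<union> neg P = points P"
    proof (rule equalityI; rule subsetI)
      fix u assume u: "u \<in> points P"
      then have "f u \<in> pos Q \<union> neg Q" using fmem ptsQ(1) by simp
      then show "u \<in> pos P \<union> neg P" using pos[OF u] neg[OF u] by simp
    qed (use P in blast)
    show "pos P \<inter> neg P = {?i}"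
    proof (rule set_eqI)
      fix u
      have "u \<in> pos P \<inter> neg P \<longleftrightarrow> f u \<in> pos Q \<inter> neg Q" if "u \<in> points P"
        using pos[OF that] neg[OF that] by simp
      then show "u \<in> pos P \<inter> neg P \<longleftrightarrow> u \<in> {?i}" using fj[of u] P unfolding ptsQ(2) by auto
    qed
  qed
  have "ranked P (s \<circ> f) N L"
    unfolding ranked_def
  proof (intro conjI ballI)
    show "bij_betw (s \<circ> f) (neg P - {?i}) N"
      using restrict[OF P(2) sub(1) neg] rankedD(5)[OF Q] by (rule bij_betw_trans)
    show "bij_betw (s \<circ> f) (pos P - {?i}) ((\<lambda>i. i + 1) ` N)"
      using restrict[OF P(1) sub(2) pos] rankedD(6)[OF Q] by (rule bij_betw_trans)
  next
    fix u assume u: "u \<in> points P"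
    show "below P u ?i" using bel[OF u P(3)] rankedD(3)[OF Q fmem[OF u]] fi by simp
    show "below P ?i u \<longleftrightarrow> u = ?i" using bel[OF P(3) u] rankedD(4)[OF Q fmem[OF u]] fi fj[OF u] by simp
  next
    fix u v assume "u \<in> points P - {?i}" "v \<in> points P - {?i}"
    then have u: "u \<in> points P" "f u \<noteq> ?j" and v: "v \<in> points P" "f v \<noteq> ?j"
      using fj[of u] fj[of v] by auto
    show "below P u v \<longleftrightarrow> (s \<circ> f) u < (s \<circ> f) v \<or>
      (s \<circ> f) u = (s \<circ> f) v \<and> ((s \<circ> f) u \<in> L \<or> (u \<in> pos P \<longleftrightarrow> v \<in> pos P))"
      using bel[OF u(1) v(1)] pos[OF u(1)] pos[OF v(1)]
        rankedD(7)[OF Q fmem[OF u(1)] fmem[OF v(1)] u(2) v(2)] by simp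
  qed (fact sign)+
  then show ?thesis by blast
qed

text \<open>Serves to move an interval of ranks to the position chosen for the crowns below.\<close>

lemma ranked_shift:
  assumes "ranked P r N L"
  shows "ranked P (\<lambda>u. r u + c) ((\<lambda>i. i + c) ` N) ((\<lambda>i. i + c) ` L)"
proof -
  have c: "bij_betw (\<lambda>i. i + c) M ((\<lambda>i. i + c) ` M)" for M :: "int set"
    by (rule bij_betw_imageI) (simp_all add: inj_on_def)
  have comp: "(\<lambda>u. r u + c) = (\<lambda>i. i + c) \<circ> r" by auto
  have comm: "(\<lambda>i. i + 1) ` (\<lambda>i. i + c) ` N = (\<lambda>i. i + c) ` (\<lambda>i. i + 1) ` N"
    by (simp add: image_image algebra_simps)
  have mem: "i + c \<in> (\<lambda>i. i + c) ` L \<longleftrightarrow> i \<in> L" for i by auto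
  show ?thesis
    unfolding ranked_def
  proof (intro conjI ballI)
    show "bij_betw (\<lambda>u. r u + c) (neg P - {identity P}) ((\<lambda>i. i + c) ` N)"
      unfolding comp by (rule bij_betw_trans[OF rankedD(5)[OF assms] c])
    show "bij_betw (\<lambda>u. r u + c) (pos P - {identity P}) ((\<lambda>i. i + 1) ` (\<lambda>i. i + c) ` N)"
      unfolding comp comm by (rule bij_betw_trans[OF rankedD(6)[OF assms] c])
  next
    fix u v assume "u \<in> points P - {identity P}" "v \<in> points P - {identity P}"
    then show "below P u v \<longleftrightarrow> r u + c < r v + c \<or>
      r u + c = r v + c \<and> (r u + c \<in> (\<lambda>i. i + c) ` L \<or> (u \<in> pos P \<longleftrightarrow> v \<in> pos P))"
      unfolding mem using rankedD(7)[OF assms, of u v] by simp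
  qed (use rankedD(1-4)[OF assms] in auto)
qed

section \<open>The vertical crowns as ranked preorders\<close>

lemmas crown_defs =
  crown_a_def crown_b_def crown_c_def crown_d_def top_identity_def oplus_def ordinal_sum_def
  one_L_def one_R_def

lemma two_LR_simps:
  "points (two_LR L i) = UNIV" "pos (two_LR L i) = {pt_a}" "neg (two_LR L i) = {pt_b}"
  "below (two_LR L i) t t' \<longleftrightarrow> i \<in> L \<or> t = t'"
  by (auto simp: two_LR_def two_L_def two_R_def)

lemma mem_shift_image: "(k :: int) \<in> (\<lambda>i. i + c) ` N \<longleftrightarrow> k - c \<in> N"
  by force

lemma two_eq_iff: "(t = pt_a \<longleftrightarrow> t' = pt_a) \<longleftrightarrow> t = t'"
  by (cases t; cases t') auto

lemma two_neq_iff: "t \<noteq> t' \<longleftrightarrow> t = pt_a \<and> t' = pt_b \<or> t = pt_b \<and> t' = pt_a"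
  by (cases t; cases t') auto

lemma ranked_crown_a:
  assumes "\<And>i. i \<in> L \<longleftrightarrow> i \<in> L'"
  shows "\<exists>s. ranked (crown_a L) s UNIV L'"
proof (rule exI)
  let ?P = "crown_a L"
  \<comment> \<open>The rank is the index of the summand; the value at the identity is a dummy, here
    and in the other crowns.\<close>
  let ?s = "case_sum fst (\<lambda>_. 0) :: (int \<times> two) + unit \<Rightarrow> int"
  show "ranked ?P ?s UNIV L'"
    unfolding ranked_def
  proof (intro conjI ballI)
    show "bij_betw ?s (neg ?P - {identity ?P}) UNIV"
      by (rule bij_betw_byWitness[where f' = "\<lambda>i. Inl (i, pt_b)"])
        (auto simp: crown_defs two_LR_simps split: if_splits)
    show "bij_betw ?s (pos ?P - {identity ?P}) ((\<lambda>i. i + 1) ` UNIV)"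
      by (rule bij_betw_byWitness[where f' = "\<lambda>i. Inl (i, pt_a)"])
        (auto simp: crown_defs two_LR_simps mem_shift_image split: if_splits)
    show "pos ?P \<union> neg ?P = points ?P"
      by (auto simp: crown_defs two_LR_simps two_neq_iff simp del: UNIV_Plus_UNIV UNIV_Times_UNIV)
    show "pos ?P \<inter> neg ?P = {identity ?P}"
      by (auto simp: crown_defs two_LR_simps)
  next
    fix u assume "u \<in> points ?P"
    show "below ?P u (identity ?P)" "below ?P (identity ?P) u \<longleftrightarrow> u = identity ?P"
      by (auto simp: crown_defs split: sum.splits)
  next
    fix u v assume "u \<in> points ?P - {identity ?P}" "v \<in> points ?P - {identity ?P}"
    then show "below ?P u v \<longleftrightarrow>
      ?s u < ?s v \<or> ?s u = ?s v \<and> (?s u \<in> L' \<or> (u \<in> pos ?P \<longleftrightarrow> v \<in> pos ?P))"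
      by (elim DiffE)
        (cases u; cases v; auto simp: crown_defs two_LR_simps two_eq_iff two_neq_iff assms split: sum.splits)
  qed
qed

text \<open>The set \<open>L'\<close> is left free at ranks with at most one element, where
  reflexivity alone decides \<open>below\<close>. The same holds for the next two crowns.\<close>

lemma ranked_crown_b:
  assumes "\<And>i. i \<in> L \<longleftrightarrow> int i + 1 \<in> L'"
  shows "\<exists>s. ranked (crown_b L) s {0..} L'"
proof (rule exI)
  let ?P = "crown_b L"
  \<comment> \<open>The bottom \<open>one_R\<close> takes rank \<open>0\<close>, so the indices move
    up by one: negative ranks start at \<open>0\<close>, positive ones at \<open>1\<close>.\<close>
  let ?s = "case_sum (case_sum (\<lambda>_. 0) (\<lambda>(i, _). int i + 1)) (\<lambda>_. 0) :: (unit + nat \<times> two) + unit \<Rightarrow> int"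
  show "ranked ?P ?s {0..} L'"
    unfolding ranked_def
  proof (intro conjI ballI)
    show "bij_betw ?s (neg ?P - {identity ?P}) {0..}"
      by (rule bij_betw_byWitness[where f' = "\<lambda>i. Inl (if i = 0 then Inl () else Inr (nat (i - 1), pt_b))"])
        (auto simp: crown_defs two_LR_simps split: if_splits)
    show "bij_betw ?s (pos ?P - {identity ?P}) ((\<lambda>i. i + 1) ` {0..})"
      by (rule bij_betw_byWitness[where f' = "\<lambda>i. Inl (Inr (nat (i - 1), pt_a))"])
        (auto simp: crown_defs two_LR_simps mem_shift_image split: if_splits)
    show "pos ?P \<union> neg ?P = points ?P"
      by (auto simp: crown_defs two_LR_simps two_neq_iff simp del: UNIV_Plus_UNIV UNIV_Times_UNIV)
    show "pos ?P \<inter> neg ?P = {identity ?P}"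
      by (auto simp: crown_defs two_LR_simps)
  next
    fix u assume "u \<in> points ?P"
    show "below ?P u (identity ?P)" "below ?P (identity ?P) u \<longleftrightarrow> u = identity ?P"
      by (auto simp: crown_defs split: sum.splits)
  next
    fix u v assume "u \<in> points ?P - {identity ?P}" "v \<in> points ?P - {identity ?P}"
    then show "below ?P u v \<longleftrightarrow>
      ?s u < ?s v \<or> ?s u = ?s v \<and> (?s u \<in> L' \<or> (u \<in> pos ?P \<longleftrightarrow> v \<in> pos ?P))"
      by (elim DiffE)
        (cases u; cases v; auto simp: crown_defs two_LR_simps two_eq_iff two_neq_iff assms split: sum.splits)
  qed
qed

lemma ranked_crown_c:
  assumes "\<And>i. i \<in> L \<longleftrightarrow> - int i - 1 \<in> L'"
  shows "\<exists>s. ranked (crown_c L) s {..-1} L'"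
proof (rule exI)
  let ?P = "crown_c L"
  \<comment> \<open>The positive \<open>one_L\<close> below the identity takes rank
    \<open>0\<close>, and the reversed indices descend from \<open>-1\<close>.\<close>
  let ?s = "case_sum (case_sum (\<lambda>(i, _). - int i - 1) (\<lambda>_. 0)) (\<lambda>_. 0) :: (nat \<times> two + unit) + unit \<Rightarrow> int"
  show "ranked ?P ?s {..-1} L'"
    unfolding ranked_def
  proof (intro conjI ballI)
    show "bij_betw ?s (neg ?P - {identity ?P}) {..-1}"
      by (rule bij_betw_byWitness[where f' = "\<lambda>i. Inl (Inl (nat (- i - 1), pt_b))"])
        (auto simp: crown_defs two_LR_simps split: if_splits)
    show "bij_betw ?s (pos ?P - {identity ?P}) ((\<lambda>i. i + 1) ` {..-1})"
      by (rule bij_betw_byWitness[where f' = "\<lambda>i. Inl (if i = 0 then Inr () else Inl (nat (- i - 1), pt_a))"])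
        (auto simp: crown_defs two_LR_simps mem_shift_image split: if_splits)
    show "pos ?P \<union> neg ?P = points ?P"
      by (auto simp: crown_defs two_LR_simps two_neq_iff simp del: UNIV_Plus_UNIV UNIV_Times_UNIV)
    show "pos ?P \<inter> neg ?P = {identity ?P}"
      by (auto simp: crown_defs two_LR_simps)
  next
    fix u assume "u \<in> points ?P"
    show "below ?P u (identity ?P)" "below ?P (identity ?P) u \<longleftrightarrow> u = identity ?P"
      by (auto simp: crown_defs split: sum.splits)
  next
    fix u v assume "u \<in> points ?P - {identity ?P}" "v \<in> points ?P - {identity ?P}"
    then show "below ?P u v \<longleftrightarrow>
      ?s u < ?s v \<or> ?s u = ?s v \<and> (?s u \<in> L' \<or> (u \<in> pos ?P \<longleftrightarrow> v \<in> pos ?P))"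
      by (elim DiffE)
        (cases u; cases v; auto simp: crown_defs two_LR_simps two_eq_iff two_neq_iff assms split: sum.splits)
  qed
qed

lemma ranked_crown_d:
  assumes "\<And>i. i \<in> {1..n} \<Longrightarrow> i \<in> L \<longleftrightarrow> int i \<in> L'"
  shows "\<exists>s. ranked (crown_d n L) s {0..int n} L'"
proof (rule exI)
  let ?P = "crown_d n L"
  \<comment> \<open>The bottom \<open>one_R\<close> has rank \<open>0\<close> and the lower
    \<open>one_L\<close> rank \<open>n + 1\<close>, so the indices \<open>1\<close> to
    \<open>n\<close> keep their values. For \<open>n = 0\<close> the ranks \<open>0\<close> and
    \<open>1\<close> remain, with one element each.\<close>
  let ?s = "case_sum (case_sum (case_sum (\<lambda>_. 0) (\<lambda>(i, _). int i)) (\<lambda>_. int n + 1)) (\<lambda>_. 0) :: ((unit + nat \<times> two) + unit) + unit \<Rightarrow> int"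
  show "ranked ?P ?s {0..int n} L'"
    unfolding ranked_def
  proof (intro conjI ballI)
    show "bij_betw ?s (neg ?P - {identity ?P}) {0..int n}"
      by (rule bij_betw_byWitness[where f' = "\<lambda>i. Inl (Inl (if i = 0 then Inl () else Inr (nat i, pt_b)))"])
        (auto simp: crown_defs two_LR_simps split: if_splits simp: Suc_le_eq nat_le_iff)
    show "bij_betw ?s (pos ?P - {identity ?P}) ((\<lambda>i. i + 1) ` {0..int n})"
      by (rule bij_betw_byWitness[where f' = "\<lambda>i. Inl (if i = int n + 1 then Inr () else Inl (Inr (nat i, pt_a)))"])
        (auto simp: crown_defs two_LR_simps mem_shift_image split: if_splits simp: Suc_le_eq nat_le_iff)
    show "pos ?P \<union> neg ?P = points ?P"
      by (auto simp: crown_defs two_LR_simps two_neq_iff simp del: UNIV_Plus_UNIV UNIV_Times_UNIV)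
    show "pos ?P \<inter> neg ?P = {identity ?P}"
      by (auto simp: crown_defs two_LR_simps)
  next
    fix u assume "u \<in> points ?P"
    show "below ?P u (identity ?P)" "below ?P (identity ?P) u \<longleftrightarrow> u = identity ?P"
      by (auto simp: crown_defs split: sum.splits)
  next
    fix u v assume "u \<in> points ?P - {identity ?P}" "v \<in> points ?P - {identity ?P}"
    then show "below ?P u v \<longleftrightarrow>
      ?s u < ?s v \<or> ?s u = ?s v \<and> (?s u \<in> L' \<or> (u \<in> pos ?P \<longleftrightarrow> v \<in> pos ?P))"
      by (elim DiffE)
        (cases u; cases v; auto simp: crown_defs two_LR_simps two_eq_iff two_neq_iff assms split: sum.splits)
  qed
qed

section \<open>Intervals of integers\<close>

definition int_convex :: "int set \<Rightarrow> bool" where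
  "int_convex N \<longleftrightarrow> (\<forall>i\<in>N. \<forall>k\<in>N. \<forall>j. i \<le> j \<and> j \<le> k \<longrightarrow> j \<in> N)"

lemma ex_least_int:
  fixes N :: "int set"
  assumes "N \<noteq> {}" "\<forall>i\<in>N. l \<le> i"
  shows "\<exists>a\<in>N. \<forall>i\<in>N. a \<le> i"
proof -
  obtain a where "a \<in> N" "\<forall>i. i \<in> N \<longrightarrow> nat (a - l) \<le> nat (i - l)"
    using assms(1) ex_has_least_nat[of "\<lambda>i. i \<in> N" _ "\<lambda>i. nat (i - l)"] by blast
  then show ?thesis using assms(2) by (force simp: nat_le_eq_zle)
qed

lemma ex_greatest_int:
  fixes N :: "int set"
  assumes "N \<noteq> {}" "\<forall>i\<in>N. i \<le> l"
  shows "\<exists>a\<in>N. \<forall>i\<in>N. i \<le> a"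
  using ex_least_int[of "uminus ` N" "- l"] assms by auto

lemma int_convex_cases:
  assumes "N \<noteq> {}" "int_convex N"
  obtains "N = UNIV" | a where "N = {a..}" | b where "N = {..b}" | a b where "a \<le> b" "N = {a..b}"
proof -
  note conv = assms(2)[unfolded int_convex_def, rule_format]
  have unbounded: "N = UNIV" if "\<And>l. \<exists>i\<in>N. i \<le> l" "\<And>l. \<exists>i\<in>N. l \<le> i"
    using that conv by (metis UNIV_eq_I)
  have "\<exists>b. N = {..b}" if "\<And>l. \<exists>i\<in>N. i \<le> l" "b \<in> N" "\<forall>i\<in>N. i \<le> b" for b
  proof (intro exI set_eqI iffI)
    fix i assume "i \<in> {..b}" then show "i \<in> N" using that conv by (metis atMost_iff)
  qed (use that in simp)
  moreover have "\<exists>a. N = {a..}" if "\<And>l. \<exists>i\<in>N. l \<le> i" "a \<in> N" "\<forall>i\<in>N. a \<le> i" for a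
  proof (intro exI set_eqI iffI)
    fix i assume "i \<in> {a..}" then show "i \<in> N" using that conv by (metis atLeast_iff)
  qed (use that in simp)
  moreover have "a \<le> b \<and> N = {a..b}" if "a \<in> N" "\<forall>i\<in>N. a \<le> i" "b \<in> N" "\<forall>i\<in>N. i \<le> b" for a b
  proof (intro conjI set_eqI iffI)
    fix i assume "i \<in> {a..b}" then show "i \<in> N" using conv[OF that(1,3)] by simp
  qed (use that in auto)
  moreover have "(\<forall>l. \<exists>i\<in>N. i \<le> l) \<or> (\<exists>a\<in>N. \<forall>i\<in>N. a \<le> i)"
    using ex_least_int[OF assms(1)] linear by blast
  moreover have "(\<forall>l. \<exists>i\<in>N. l \<le> i) \<or> (\<exists>b\<in>N. \<forall>i\<in>N. i \<le> b)"
    using ex_greatest_int[OF assms(1)] linear by blast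
  ultimately show ?thesis using that unbounded by blast
qed

section \<open>Crownian chains are those ranked over a nonempty interval\<close>

lemma crownian_iff_ranked:
  "crownian TYPE('a::idempotent_residuated_chain) \<longleftrightarrow>
    (\<exists>r N L. ranked (monoidal_preorder :: 'a starred_enhanced_preorder) r N L \<and> N \<noteq> {} \<and> int_convex N)"
  (is "_ \<longleftrightarrow> (\<exists>r N L. ranked ?A r N L \<and> _ N \<and> _ N)")
proof
  have A: "pos ?A \<subseteq> points ?A" "neg ?A \<subseteq> points ?A" "identity ?A \<in> points ?A"
    by (simp_all add: monoidal_preorder_def)
  have convex: "int_convex UNIV" "int_convex {0..}" "int_convex {..-1}" "int_convex {0..int n}" for n
    by (auto simp: int_convex_def)
  have transfer: "\<exists>r N L. ranked ?A r N L \<and> N \<noteq> {} \<and> int_convex N"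
    if "isomorphic ?A C" "\<exists>s. ranked C s N L" "N \<noteq> {}" "int_convex N"
    for C :: "'p pointed_enhanced_preorder" and N L
    using ranked_if_isomorphic[OF that(1) _ A] that(2-4) by blast
  assume "crownian TYPE('a)"
  then consider (a) L where "isomorphic ?A (crown_a L)" | (b) L where "isomorphic ?A (crown_b L)"
    | (c) L where "isomorphic ?A (crown_c L)" | (d) n L where "isomorphic ?A (crown_d n L)"
    unfolding crownian_def Let_def by blast
  then show "\<exists>r N L. ranked ?A r N L \<and> N \<noteq> {} \<and> int_convex N"
  proof cases
    case a
    show ?thesis by (rule transfer[OF a ranked_crown_a]) (auto simp: convex)
  next
    case (b L)
    show ?thesis
      by (rule transfer[OF b ranked_crown_b[where L' = "(\<lambda>i. int i + 1) ` L"]]) (auto simp: convex)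
  next
    case (c L)
    show ?thesis
      by (rule transfer[OF c ranked_crown_c[where L' = "(\<lambda>i. - int i - 1) ` L"]]) (auto simp: convex)
  next
    case (d n L)
    show ?thesis
      by (rule transfer[OF d ranked_crown_d[where L' = "int ` L"]]) (auto simp: convex)
  qed
next
  assume "\<exists>r N L. ranked ?A r N L \<and> N \<noteq> {} \<and> int_convex N"
  then obtain r N L where r: "ranked ?A r N L" and N: "N \<noteq> {}" "int_convex N" by blast
  \<comment> \<open>After shifting \<open>N\<close> onto \<open>M\<close>, the shifted set
    \<open>L\<close> is matched by a suitable set of crown indices, supplied by the second
    premise.\<close>
  have iso: "\<exists>L. isomorphic ?A (C L)"
    if "(\<lambda>i. i + c) ` N = M" "\<And>L'. \<exists>L s. ranked (C L) s M L'"
    for C :: "'i set \<Rightarrow> 'p pointed_enhanced_preorder" and c M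
    using ranked_shift[OF r, of c] that isomorphic_if_ranked by metis
  from N show "crownian TYPE('a)"
  proof (cases rule: int_convex_cases)
    case 1
    have "\<exists>L. isomorphic ?A (crown_a L)"
    proof (rule iso)
      show "(\<lambda>i. i + 0) ` N = UNIV" using 1 by simp
    qed (meson ranked_crown_a)
    then show ?thesis unfolding crownian_def Let_def by blast
  next
    case (2 a)
    have "\<exists>L. isomorphic ?A (crown_b L)"
    proof (rule iso)
      show "(\<lambda>i. i + (- a)) ` N = {0..}" using 2 unfolding set_eq_iff mem_shift_image by simp
      show "\<exists>L s. ranked (crown_b L) s {0..} L'" for L'
        using ranked_crown_b[of "{i. int i + 1 \<in> L'}" L'] by blast
    qed
    then show ?thesis unfolding crownian_def Let_def by blast
  next
    case (3 b)
    have "\<exists>L. isomorphic ?A (crown_c L)"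
    proof (rule iso)
      show "(\<lambda>i. i + (- b - 1)) ` N = {..-1}" using 3 unfolding set_eq_iff mem_shift_image by auto
      show "\<exists>L s. ranked (crown_c L) s {..-1} L'" for L'
        using ranked_crown_c[of "{i. - int i - 1 \<in> L'}" L'] by blast
    qed
    then show ?thesis unfolding crownian_def Let_def by blast
  next
    case (4 a b)
    \<comment> \<open>Definition (d) demands \<open>L \<subseteq> {1..n}\<close>, which
      \<open>iso\<close> does not control, so the index set is written out. Shifting by
      \<open>- a\<close> turns \<open>{a..b}\<close> into \<open>{0..b - a}\<close>.\<close>
    let ?n = "nat (b - a)" and ?L' = "(\<lambda>i. i + (- a)) ` L"
    have "(\<lambda>i. i + (- a)) ` N = {0..int ?n}"
      by (rule set_eqI, unfold mem_shift_image) (use 4 in auto)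
    then have "ranked ?A (\<lambda>u. r u + (- a)) {0..int ?n} ?L'"
      using ranked_shift[OF r, of "- a"] by simp
    moreover obtain s where "ranked (crown_d ?n {i \<in> {1..?n}. int i \<in> ?L'}) s {0..int ?n} ?L'"
      using ranked_crown_d[of ?n "{i \<in> {1..?n}. int i \<in> ?L'}" ?L'] by auto
    ultimately have "isomorphic ?A (crown_d ?n {i \<in> {1..?n}. int i \<in> ?L'})"
      by (rule isomorphic_if_ranked)
    moreover have "{i \<in> {1..?n}. int i \<in> ?L'} \<subseteq> {1..?n}" by blast
    ultimately show ?thesis unfolding crownian_def Let_def by blast
  qed
qed

section \<open>Chains with a rank function\<close>

lemma monoidal_le_iff: "x \<sqsubseteq> y \<longleftrightarrow> x \<sqsubset> y \<or> x \<asymp> y \<and> x * y = x"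
  by (auto simp: below_strict_def monoidal_le_def)

text \<open>Within one rank the condition involving \<open>L\<close> and the signs is symmetric, so
  it disappears from the strict part.\<close>

lemma ranked_monoidalD:
  fixes r :: "'a::idempotent_residuated_chain \<Rightarrow> int"
  assumes "ranked (monoidal_preorder :: 'a starred_enhanced_preorder) r N L"
  shows "bij_betw r {..<1} N" "bij_betw r {1<..} ((\<lambda>i. i + 1) ` N)"
    and "x \<noteq> 1 \<Longrightarrow> y \<noteq> 1 \<Longrightarrow> x \<sqsubset> y \<longleftrightarrow> r x < r y"
proof -
  let ?A = "monoidal_preorder :: 'a starred_enhanced_preorder"
  have "neg ?A - {identity ?A} = {..<1}" "pos ?A - {identity ?A} = {1<..}"
    by (auto simp: monoidal_preorder_def)
  then show "bij_betw r {..<1} N" "bij_betw r {1<..} ((\<lambda>i. i + 1) ` N)"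
    using rankedD(5,6)[OF assms] by simp_all
  assume "x \<noteq> 1" "y \<noteq> 1"
  then show "x \<sqsubset> y \<longleftrightarrow> r x < r y"
    using rankedD(7)[OF assms, of x y] rankedD(7)[OF assms, of y x]
    by (auto simp: monoidal_preorder_def below_strict_def)
qed

context
  fixes r :: "'a::idempotent_residuated_chain \<Rightarrow> int" and N L
  assumes ranked: "ranked (monoidal_preorder :: 'a starred_enhanced_preorder) r N L"
begin

text \<open>Some positive \<open>a\<close> has rank \<open>r b + 1\<close>. It lies above
  \<open>b\<close>, so \<open>a \<le> star b\<close>, and order reversal on positive elements bounds
  the rank of \<open>star b\<close> by that of \<open>a\<close>. Being strictly above
  \<open>b\<close>, \<open>star b\<close> cannot have a smaller rank either.\<close>

lemma rank_star_neg:
  assumes b: "b < 1"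
  shows "1 < star b" "r (star b) = r b + 1"
proof -
  have "r b \<in> N" using ranked_monoidalD(1)[OF ranked] b by (auto simp: bij_betw_def)
  then have "r b + 1 \<in> r ` {1<..}" using ranked_monoidalD(2)[OF ranked] by (simp add: bij_betw_def)
  then obtain a where a: "1 < a" "r a = r b + 1" by auto
  then have "b \<sqsubset> a" using ranked_monoidalD(3)[OF ranked] b by simp
  then have le: "a \<le> star b" using neg_below_pos_iff(1) a b by blast
  then show pos: "1 < star b" using a by simp
  then have "\<not> a \<sqsubset> star b" using le a below_strict_pos_pos[of a "star b"] by simp
  then have "\<not> r a < r (star b)" using ranked_monoidalD(3)[OF ranked] a pos by simp
  moreover have "r b < r (star b)" using ranked_monoidalD(3)[OF ranked] below_star_neg[OF b] b pos by simp
  ultimately show "r (star b) = r b + 1" using a by simp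
qed

lemma rank_star_pos:
  assumes a: "1 < a"
  shows "r (star a) = r a - 1"
proof -
  have "r a \<in> (\<lambda>i. i + 1) ` N" using ranked_monoidalD(2)[OF ranked] a by (auto simp: bij_betw_def)
  then have "r a - 1 \<in> r ` {..<1}"
    using ranked_monoidalD(1)[OF ranked] by (simp add: bij_betw_def mem_shift_image)
  then obtain b where b: "b < 1" "r b = r a - 1" by force
  then have "b \<sqsubset> a" using ranked_monoidalD(3)[OF ranked] a by simp
  then have le: "b \<le> star a" using neg_below_pos_iff(2) a b by blast
  have neg: "star a < 1" using inv_pos(3)[OF a] .
  then have "\<not> star a \<sqsubset> b" using le b below_strict_neg_neg[of "star a" b] by simp
  then have "\<not> r (star a) < r b" using ranked_monoidalD(3)[OF ranked] b neg by simp
  moreover have "r (star a) < r a" using ranked_monoidalD(3)[OF ranked] star_pos_below[OF a] a neg by simp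
  ultimately show "r (star a) = r a - 1" using b by simp
qed

text \<open>Applying \<open>star\<close> twice restores both rank and sign of a non-identity
  element, and \<open>r\<close> is injective on each sign.\<close>

lemma star_involutive_if_ranked: "star_involutive TYPE('a)"
  unfolding star_involutive_def
proof
  fix x :: 'a
  consider "x = 1" | "x < 1" | "1 < x" by fastforce
  then show "star (star x) = x"
  proof cases
    case 1 then show ?thesis by (simp add: star_one)
  next
    case 2
    then show ?thesis
      using rank_star_neg[OF 2] rank_star_pos[of "star x"] inv_pos(3)[of "star x"]
        inj_onD[OF bij_betw_imp_inj_on[OF ranked_monoidalD(1)[OF ranked]], of "star (star x)" x] by simp
  next
    case 3
    then show ?thesis
      using rank_star_pos[OF 3] rank_star_neg[of "star x"] inv_pos(3)[of x]
        inj_onD[OF bij_betw_imp_inj_on[OF ranked_monoidalD(2)[OF ranked]], of "star (star x)" x] by simp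
  qed
qed

text \<open>Going up, \<open>c\<close> shares the rank of \<open>star b\<close>. Going down, it is
  \<open>star c\<close> that shares the rank of \<open>b\<close>, and a second \<open>star\<close>
  recovers \<open>c\<close>.\<close>

lemma inv_closure_neg_step:
  assumes b: "b < 1" "b \<in> inv_closure x" and c: "c < 1" "r c = r b + 1 \<or> r c = r b - 1"
  shows "c \<in> inv_closure x"
proof -
  have *: "u \<asymp> v" if "u \<noteq> 1" "v \<noteq> 1" "r u = r v" for u v
    using ranked_monoidalD(3)[OF ranked] that by simp
  from c(2) show ?thesis
  proof
    assume "r c = r b + 1"
    then have "c \<asymp> star b" using * rank_star_neg[OF b(1)] c(1) by simp
    then show ?thesis
      using same_rank_mem_inv_closure[OF star_mem_inv_closure[OF b(2)]] rank_star_neg[OF b(1)] by simp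
  next
    assume "r c = r b - 1"
    then have "star c \<asymp> b" using * rank_star_neg[OF c(1)] b(1) by simp
    then have "star c \<in> inv_closure x" using same_rank_mem_inv_closure[OF b(2)] b(1) by simp
    then have "star (star c) \<in> inv_closure x" by (rule star_mem_inv_closure)
    then show ?thesis using star_involutive_if_ranked by (simp add: star_involutive_def)
  qed
qed

text \<open>Any negative \<open>x\<close> generates: since the interval \<open>N\<close> has no
  gaps, every negative element is reached by unit steps from \<open>x\<close>, and every positive
  one is the \<open>star\<close> of a negative one.\<close>

lemma one_generated_if_ranked:
  assumes "N \<noteq> {}" "int_convex N"
  shows "one_generated TYPE('a)"
proof -
  have N: "N = r ` {..<1}" using ranked_monoidalD(1)[OF ranked] by (simp add: bij_betw_def)
  then obtain x :: 'a where x: "x < 1" using assms(1) by auto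
  have conv: "\<exists>b<1. r b = j" if "i \<le> j" "j \<le> k" "i \<in> N" "k \<in> N" for i j k
  proof -
    have "j \<in> N" using that assms(2) unfolding int_convex_def by blast
    then show ?thesis unfolding N by auto
  qed
  have xN: "r x \<in> N" using x N by simp
  have up: "b < 1 \<Longrightarrow> r b = r x + int n \<Longrightarrow> b \<in> inv_closure x" for n b
  proof (induction n arbitrary: b)
    case 0
    then have "b = x"
      using inj_onD[OF bij_betw_imp_inj_on[OF ranked_monoidalD(1)[OF ranked]], of b x] x by simp
    then show ?case by (simp add: inv_closure.base)
  next
    case (Suc n)
    have bN: "r b \<in> N" using N Suc.prems(1) by blast
    have "\<exists>c<1. r c = r x + int n" using Suc.prems(2) by (intro conv[OF _ _ xN bN]) simp_all
    then obtain c where "c < 1" "r c = r x + int n" by blast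
    then show ?case using Suc inv_closure_neg_step[of c x b] by simp
  qed
  have down: "b < 1 \<Longrightarrow> r b = r x - int n \<Longrightarrow> b \<in> inv_closure x" for n b
  proof (induction n arbitrary: b)
    case 0
    then show ?case using up[of b 0] by simp
  next
    case (Suc n)
    have bN: "r b \<in> N" using N Suc.prems(1) by blast
    have "\<exists>c<1. r c = r x - int n" using Suc.prems(2) by (intro conv[OF _ _ bN xN]) simp_all
    then obtain c where "c < 1" "r c = r x - int n" by blast
    then show ?case using Suc inv_closure_neg_step[of c x b] by simp
  qed
  have neg: "b \<in> inv_closure x" if "b < 1" for b
    using up[OF that, of "nat (r b - r x)"] down[OF that, of "nat (r x - r b)"] by linarith
  have "y \<in> subalgebra_gen {x}" for y
  proof -
    consider "y = 1" | "y < 1" | "1 < y" by fastforce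
    then show ?thesis
    proof cases
      case 3
      then have "star (star y) \<in> inv_closure x" by (intro star_mem_inv_closure neg inv_pos)
      then show ?thesis using star_involutive_if_ranked inv_closure_subset_subalgebra_gen[of x]
        by (auto simp: star_involutive_def)
    qed (use neg inv_closure_subset_subalgebra_gen[of x] subalgebra_gen.one in blast)+
  qed
  then show ?thesis unfolding one_generated_def by blast
qed

end

section \<open>Building the ranked structure from ranks compatible with \<open>star\<close>\<close>

text \<open>A rank has at most two elements, and distinct ones do not commute, so multiplication
  there is a left or a right projection. The chosen \<open>L\<close> collects the ranks with two
  elements and left projection: these are the copies of \<open>two_L\<close>, each element lying
  below the other.\<close>

lemma ranked_monoidalI:
  fixes r :: "'a::idempotent_residuated_chain \<Rightarrow> int"
  assumes inv: "star_involutive TYPE('a)"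
    and less: "\<And>x y. x \<noteq> 1 \<Longrightarrow> y \<noteq> 1 \<Longrightarrow> x \<sqsubset> y \<longleftrightarrow> r x < r y"
    and star: "\<And>b. b < 1 \<Longrightarrow> r (star b) = r b + 1"
  shows "ranked (monoidal_preorder :: 'a starred_enhanced_preorder) r (r ` {..<1})
    {k. \<exists>y z. y \<noteq> 1 \<and> z \<noteq> 1 \<and> y \<noteq> z \<and> r y = k \<and> r z = k \<and> y * z = y}"
    (is "ranked ?A r ?N ?L")
proof -
  have sets: "neg ?A - {1} = {..<1}" "pos ?A - {1} = {1<..}" "identity ?A = 1"
    by (auto simp: monoidal_preorder_def)
  have same: "u \<asymp> v" if "u \<noteq> 1" "v \<noteq> 1" "r u = r v" for u v
    using less that by simp
  have inj: "inj_on r {..<1}" "inj_on r {1<..}"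
    by (intro inj_onI same_rank_same_sign[OF same]; simp add: less_imp_le)+
  \<comment> \<open>A positive \<open>a\<close> is \<open>star\<close> of the negative element
    \<open>star a\<close>, whose rank is one lower.\<close>
  have "r ` {1<..} = (\<lambda>i. i + 1) ` ?N"
  proof (intro set_eqI iffI)
    fix k assume "k \<in> r ` {1<..}"
    then obtain a where a: "1 < a" "k = r a" by auto
    then have "star a < 1" "star (star a) = a" using inv_pos(3) inv by (auto simp: star_involutive_def)
    then have "r a = r (star a) + 1" using star[of "star a"] by simp
    then show "k \<in> (\<lambda>i. i + 1) ` ?N" using a \<open>star a < 1\<close> by blast
  next
    fix k assume "k \<in> (\<lambda>i. i + 1) ` ?N"
    then obtain b where "b < 1" "k = r b + 1" by auto
    then show "k \<in> r ` {1<..}" using star[of b] star_neg_gt_one[OF inv, of b] by force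
  qed
  then have bij: "bij_betw r {..<1} ?N" "bij_betw r {1<..} ((\<lambda>i. i + 1) ` ?N)"
    using inj by (auto intro: bij_betw_imageI)
  have below: "u \<sqsubseteq> v \<longleftrightarrow> r u < r v \<or> r u = r v \<and> (r u \<in> ?L \<or> (1 \<le> u \<longleftrightarrow> 1 \<le> v))"
    if uv: "u \<noteq> 1" "v \<noteq> 1" for u v
  proof (cases "r u = r v")
    case False
    then show ?thesis using monoidal_le_iff[of u v] less[OF uv] less[OF uv(2,1)] by auto
  next
    case True
    then have "u \<asymp> v" using same uv by blast
    then have le: "u \<sqsubseteq> v \<longleftrightarrow> u * v = u" by (simp add: monoidal_le_iff)
    show ?thesis
    proof (cases "1 \<le> u \<longleftrightarrow> 1 \<le> v")
      case sign: True
      then have "u = v" using same_rank_same_sign[OF \<open>u \<asymp> v\<close>] by (meson linear)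
      then show ?thesis using le by (simp add: mult_idem)
    next
      case sign: False
      have "u * v = u" if "r u \<in> ?L"
      proof -
        from that obtain y z where yz: "y \<noteq> 1" "z \<noteq> 1" "y \<noteq> z" "r y = r u" "r z = r u" "y * z = y"
          by auto
        have eq: "w = w'" if "w \<noteq> 1" "w' \<noteq> 1" "r w = r w'" "1 \<le> w \<longleftrightarrow> 1 \<le> w'" for w w'
          using same_rank_same_sign[OF same[OF that(1-3)]] that(4) by (meson linear)
        \<comment> \<open>Both pairs consist of one positive and one negative element of the same
          rank.\<close>
        have "y = u \<and> z = v \<or> y = v \<and> z = u" using eq yz uv True sign by metis
        then show ?thesis
        proof
          assume "y = v \<and> z = u"
          then have vu: "v * u = v" using yz by simp
          have "u * v \<noteq> v * u" using noncommuting_if_same_rank[OF \<open>u \<asymp> v\<close>] sign by blast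
          then show ?thesis using vu mult_conservative[of u v] by auto
        qed (use yz in simp)
      qed
      moreover have "r u \<in> ?L" if "u * v = u"
      proof (intro CollectI exI conjI)
        show "u \<noteq> v" using sign by blast
        show "r v = r u" using True by simp
      qed (use that uv in simp_all)
      ultimately have "r u \<in> ?L \<longleftrightarrow> u * v = u" by (rule iffI)
      moreover have "\<not> r u < r v" using True by simp
      ultimately show ?thesis using le True sign by argo
    qed
  qed
  show ?thesis
    unfolding ranked_def sets
  proof (intro conjI ballI)
    fix u v assume "u \<in> points ?A - {1}" "v \<in> points ?A - {1}"
    then show "below ?A u v \<longleftrightarrow> r u < r v \<or> r u = r v \<and> (r u \<in> ?L \<or> (u \<in> pos ?A \<longleftrightarrow> v \<in> pos ?A))"
      using below[of u v] by (simp add: monoidal_preorder_def)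
  qed (use bij linear[of "1 :: 'a"] in \<open>auto simp: monoidal_preorder_def monoidal_le_def\<close>)
qed

section \<open>Ranks relative to a generator\<close>

text \<open>Moves up are only allowed from nonnegative ranks and moves down from nonpositive ones, so
  that every nonzero rank is entered from its neighbour closer to \<open>0\<close>. Closure under unrestricted
  moves is then a consequence of \<open>star\<close> being involutive.\<close>

inductive rank_at :: "'a::idempotent_residuated_chain \<Rightarrow> 'a \<Rightarrow> int \<Rightarrow> bool" for x where
  base: "y \<noteq> 1 \<Longrightarrow> y \<asymp> x \<Longrightarrow> rank_at x y 0"
| up: "y \<noteq> 1 \<Longrightarrow> rank_at x w k \<Longrightarrow> 0 \<le> k \<Longrightarrow> w < 1 \<Longrightarrow> y \<asymp> star w \<Longrightarrow> rank_at x y (k + 1)"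
| down: "y \<noteq> 1 \<Longrightarrow> rank_at x w k \<Longrightarrow> k \<le> 0 \<Longrightarrow> 1 < w \<Longrightarrow> y \<asymp> star w \<Longrightarrow> rank_at x y (k - 1)"

lemma rank_at_not_one: "rank_at x y k \<Longrightarrow> y \<noteq> 1"
  by (erule rank_at.cases) auto

lemma rank_at_zero: "rank_at x y 0 \<Longrightarrow> y \<asymp> x"
  by (erule rank_at.cases) auto

lemma rank_at_pos:
  assumes "rank_at x y (k + 1)" "0 \<le> k"
  obtains w where "rank_at x w k" "w < 1" "y \<asymp> star w"
  using assms by (cases rule: rank_at.cases) auto

lemma rank_at_neg:
  assumes "rank_at x y (k - 1)" "k \<le> 0"
  obtains w where "rank_at x w k" "1 < w" "y \<asymp> star w"
  using assms by (cases rule: rank_at.cases) auto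

lemma rank_at_same_rank:
  assumes "rank_at x y k" "z \<asymp> y"
  shows "rank_at x z k"
proof -
  have z: "z \<noteq> 1" using rank_at_not_one[OF assms(1)] assms(2) below_strict_one(1)[of y] by blast
  from assms(1) show ?thesis
  proof cases
    case base
    then show ?thesis using same_rank_trans[OF assms(2)] rank_at.base[OF z] by blast
  next
    case (up w k)
    then show ?thesis using same_rank_trans[OF assms(2)] rank_at.up[OF z up(3-5)] by blast
  next
    case (down w k)
    then show ?thesis using same_rank_trans[OF assms(2)] rank_at.down[OF z down(3-5)] by blast
  qed
qed

text \<open>A derivation of rank \<open>m\<close> passes through every rank between \<open>0\<close>
  and \<open>m\<close>.\<close>

lemma rank_at_intermediate:
  assumes "rank_at x z m" "0 \<le> j \<and> j \<le> m \<or> m \<le> j \<and> j \<le> 0"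
  shows "\<exists>y. rank_at x y j"
  using assms
proof (induction arbitrary: j)
  case (base y)
  then show ?case using rank_at.base[of y x] by (metis order_antisym)
next
  case (up y w k)
  then show ?case using rank_at.up[OF up(1-5)] by (cases "j = k + 1") auto
next
  case (down y w k)
  then show ?case using rank_at.down[OF down(1-5)] by (cases "j = k - 1") auto
qed

lemma rank_at_convex:
  assumes "rank_at x y i" "rank_at x z k" "i \<le> j" "j \<le> k"
  shows "\<exists>u. rank_at x u j"
  using rank_at_intermediate[OF assms(1), of j] rank_at_intermediate[OF assms(2), of j] assms(3,4)
  by (cases "0 \<le> j") auto

text \<open>The predecessors \<open>w\<close> and \<open>w'\<close> have the same rank by induction
  and the same sign by the rule applied, so they coincide, and \<open>y\<close> and \<open>z\<close>
  share the rank of their \<open>star\<close>.\<close>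

lemma rank_at_unique:
  assumes "rank_at x y k" "rank_at x z k"
  shows "y \<asymp> z"
  using assms
proof (induction arbitrary: z)
  case (base y)
  then show ?case using rank_at_zero[of x z] same_rank_trans[of y x z] by blast
next
  case (up y w k)
  obtain w' where w': "rank_at x w' k" "w' < 1" "z \<asymp> star w'" using rank_at_pos[OF up.prems up(3)] .
  then have "w = w'" using same_rank_same_sign[OF up.IH[OF w'(1)]] up(4) w'(2) by (simp add: less_imp_le)
  then show ?case using up(5) w'(3) same_rank_trans[of y "star w" z] by blast
next
  case (down y w k)
  obtain w' where w': "rank_at x w' k" "1 < w'" "z \<asymp> star w'" using rank_at_neg[OF down.prems down(3)] .
  then have "w = w'" using same_rank_same_sign[OF down.IH[OF w'(1)]] down(4) w'(2) by (simp add: less_imp_le)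
  then show ?case using down(5) w'(3) same_rank_trans[of y "star w" z] by blast
qed

text \<open>Of the ranks \<open>k\<close> and \<open>k + 1\<close>, the one farther from
  \<open>0\<close> was derived from the other by \<open>star\<close>, which moves strictly in the
  preorder.\<close>

lemma rank_at_step:
  assumes "rank_at x w k" "rank_at x z (k + 1)"
  shows "w \<sqsubset> z"
proof (cases "0 \<le> k")
  case True
  then obtain w' where w': "rank_at x w' k" "w' < 1" "z \<asymp> star w'" using rank_at_pos[OF assms(2)] by blast
  then have "w' \<sqsubset> star w'" "w \<asymp> w'" using below_star_neg rank_at_unique[OF assms(1)] by blast+
  then show ?thesis using w'(3) below_strict_negatrans by blast
next
  case False
  have "rank_at x w ((k + 1) - 1)" using assms(1) by simp
  then obtain w' where w': "rank_at x w' (k + 1)" "1 < w'" "w \<asymp> star w'"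
    using rank_at_neg[of x w "k + 1"] False by auto
  then have "star w' \<sqsubset> w'" "z \<asymp> w'" using star_pos_below rank_at_unique[OF assms(2)] by blast+
  then show ?thesis using w'(3) below_strict_negatrans by blast
qed

lemma rank_at_less:
  assumes "rank_at x y k" "rank_at x z m" "k < m"
  shows "y \<sqsubset> z"
proof -
  have "rank_at x z (k + 1 + int n) \<Longrightarrow> y \<sqsubset> z" for n z
  proof (induction n arbitrary: z)
    case 0
    then show ?case using rank_at_step[OF assms(1)] by simp
  next
    case (Suc n)
    obtain u where u: "rank_at x u (k + 1 + int n)"
      using rank_at_convex[OF assms(1) Suc.prems, of "k + 1 + int n"] by auto
    have "rank_at x z (k + 1 + int n + 1)" using Suc.prems by (simp add: algebra_simps)
    then show ?case using Suc.IH[OF u] rank_at_step[OF u] below_strict_trans by blast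
  qed
  from this[of z "nat (m - k - 1)"] show ?thesis using assms(2,3) by simp
qed

lemma rank_at_fun:
  assumes "rank_at x y k" "rank_at x y m"
  shows "k = m"
  using rank_at_less[OF assms] rank_at_less[OF assms(2,1)] below_strict_irrefl by (meson linorder_neqE)

lemma rank_at_less_iff:
  assumes "rank_at x y k" "rank_at x z m"
  shows "y \<sqsubset> z \<longleftrightarrow> k < m"
proof (cases "k = m")
  case True
  then show ?thesis using rank_at_unique[OF assms(1)] assms(2) by blast
next
  case False
  then show ?thesis
    using rank_at_less[OF assms] rank_at_less[OF assms(2,1)] below_strict_trans below_strict_irrefl
    by (meson linorder_neqE)
qed

text \<open>A move away from \<open>0\<close> is a rule. For a move towards \<open>0\<close>, invert
  the rule that produced \<open>y\<close> from \<open>w\<close>: equal rank and sign give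
  \<open>y = star w\<close>, so \<open>star y = w\<close>.\<close>

lemma rank_at_star:
  fixes x y :: "'a::idempotent_residuated_chain"
  assumes inv: "star_involutive TYPE('a)" and y: "rank_at x y k"
  shows "y < 1 \<Longrightarrow> rank_at x (star y) (k + 1)" "1 < y \<Longrightarrow> rank_at x (star y) (k - 1)"
proof -
  have starstar: "star (star w) = w" for w :: 'a using inv by (simp add: star_involutive_def)
  show "rank_at x (star y) (k + 1)" if "y < 1"
  proof (cases "0 \<le> k")
    case True
    have "star y \<noteq> 1" using star_neg_gt_one[OF inv that] by simp
    then show ?thesis using rank_at.up[OF _ y True that] below_strict_irrefl by blast
  next
    case False
    then obtain w where w: "rank_at x w (k + 1)" "1 < w" "y \<asymp> star w"
      using rank_at_neg[of x y "k + 1"] y by auto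
    then have "y = star w" using same_rank_same_sign[OF w(3)] inv_pos(3)[OF w(2)] that by (simp add: less_imp_le)
    then show ?thesis using w(1) starstar by simp
  qed
  show "rank_at x (star y) (k - 1)" if "1 < y"
  proof (cases "k \<le> 0")
    case True
    have "star y \<noteq> 1" using inv_pos(3)[OF that] by simp
    then show ?thesis using rank_at.down[OF _ y True that] below_strict_irrefl by blast
  next
    case False
    then obtain w where w: "rank_at x w (k - 1)" "w < 1" "y \<asymp> star w"
      using rank_at_pos[of x y "k - 1"] y by auto
    then have "y = star w" using same_rank_same_sign[OF w(3)] star_neg_gt_one[OF inv w(2)] that by (simp add: less_imp_le)
    then show ?thesis using w(1) starstar by simp
  qed
qed

lemma rank_at_total:
  fixes x y :: "'a::idempotent_residuated_chain"
  assumes inv: "star_involutive TYPE('a)" and x: "x \<noteq> 1" and "y \<in> inv_closure x"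
  shows "\<exists>k. rank_at x y k"
  using assms(3)
proof induction
  have step: "\<exists>m. rank_at x z m" if "\<exists>k. rank_at x y k" "z = star y \<or> z \<asymp> y" for y z
  proof -
    from that(1) obtain k where k: "rank_at x y k" by blast
    then have "\<exists>m. rank_at x (star y) m"
      using rank_at_star[OF inv k] rank_at_not_one[OF k] by (meson linorder_neqE)
    then show ?thesis using that(2) rank_at_same_rank[OF k] by blast
  qed
  {
    case base show ?case using rank_at.base[OF x] below_strict_irrefl by blast
  next
    case (linv y) then show ?case using step linv_cases by blast
  next
    case (rinv y) then show ?case using step rinv_cases by blast
  }
qed

text \<open>For \<open>0 \<le> j < k\<close> the rank \<open>j + 1\<close> is occupied and was
  derived from a negative element of rank \<open>j\<close>. For \<open>j < 0\<close> the rank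
  \<open>j\<close> was derived from a positive \<open>w\<close> of rank \<open>j + 1\<close>, and
  \<open>star w\<close> is the required negative element.\<close>

lemma int_convex_neg_ranks:
  fixes x :: "'a::idempotent_residuated_chain"
  assumes inv: "star_involutive TYPE('a)"
  shows "int_convex {k. \<exists>b<1. rank_at x b k}"
  unfolding int_convex_def
proof (intro ballI allI impI)
  fix i k j
  assume "i \<in> {k. \<exists>b<1. rank_at x b k}" "k \<in> {k. \<exists>b<1. rank_at x b k}" and j: "i \<le> j \<and> j \<le> k"
  then obtain b c where b: "rank_at x b i" and c: "c < 1" "rank_at x c k" by blast
  consider "j = k" | "j < k" "0 \<le> j" | "j < 0" using j by linarith
  then show "j \<in> {k. \<exists>b<1. rank_at x b k}"
  proof cases
    case 1 then show ?thesis using c by blast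
  next
    case 2
    then obtain u where "rank_at x u (j + 1)" using rank_at_convex[OF b c(2), of "j + 1"] j by auto
    then obtain w where "rank_at x w j" "w < 1" using rank_at_pos 2(2) by metis
    then show ?thesis by blast
  next
    case 3
    obtain u where u: "rank_at x u j" using rank_at_convex[OF b c(2), of j] j by auto
    then obtain w where w: "rank_at x w (j + 1)" "1 < w"
      using rank_at_neg[of x u "j + 1"] 3 by auto
    then have "rank_at x (star w) j" using rank_at_star(2)[OF inv w] by simp
    then show ?thesis using inv_pos(3)[OF w(2)] by blast
  qed
qed

lemma ranked_if_one_generated:
  assumes inv: "star_involutive TYPE('a::idempotent_residuated_chain)" and gen: "one_generated TYPE('a)"
    and nontriv: "\<exists>x y::'a. x \<noteq> y"
  shows "\<exists>r N L. ranked (monoidal_preorder :: 'a starred_enhanced_preorder) r N L \<and> N \<noteq> {} \<and> int_convex N"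
proof -
  obtain x :: 'a where "subalgebra_gen {x} = UNIV" using gen by (auto simp: one_generated_def)
  then have closure: "y \<in> inv_closure x" if "y \<noteq> 1" for y using subalgebra_gen_subset[of x] that by blast
  \<comment> \<open>The closure of \<open>1\<close> is \<open>{1}\<close>, so in a non-trivial chain
    \<open>1\<close> is not a generator.\<close>
  have x: "x \<noteq> 1"
  proof
    assume "x = 1"
    moreover obtain y :: 'a where y: "y \<noteq> 1" using nontriv by metis
    have "z = 1" if "z \<in> inv_closure 1" for z :: 'a
      using that
    proof induction
      case (linv y)
      then show ?case using linv_cases[of y] star_one below_strict_one by metis
    next
      case (rinv y)
      then show ?case using rinv_cases[of y] star_one below_strict_one by metis
    qed simp
    ultimately show False using closure[OF y] y by blast
  qed
  \<comment> \<open>The value \<open>r 1\<close> is meaningless; only ranks of non-identity elements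
    are used.\<close>
  define r where "r y = (THE k. rank_at x y k)" for y
  have r: "rank_at x y (r y)" if y: "y \<noteq> 1" for y
  proof -
    obtain k where k: "rank_at x y k" using rank_at_total[OF inv x closure[OF y]] by blast
    then show ?thesis unfolding r_def by (rule theI) (rule rank_at_fun[OF _ k])
  qed
  have "r (star b) = r b + 1" if "b < 1" for b
    using rank_at_fun[OF r[of "star b"] rank_at_star(1)[OF inv r that]] star_neg_gt_one[OF inv that] that
    by simp
  moreover have "u \<sqsubset> v \<longleftrightarrow> r u < r v" if "u \<noteq> 1" "v \<noteq> 1" for u v
    using rank_at_less_iff[OF r r] that by blast
  ultimately have ranked: "ranked (monoidal_preorder :: 'a starred_enhanced_preorder) r (r ` {..<1})
    {k. \<exists>y z. y \<noteq> 1 \<and> z \<noteq> 1 \<and> y \<noteq> z \<and> r y = k \<and> r z = k \<and> y * z = y}"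
    by (intro ranked_monoidalI[OF inv])
  have "r ` {..<1} = {k. \<exists>b<1. rank_at x b k}"
  proof (intro set_eqI iffI)
    fix k assume "k \<in> {k. \<exists>b<1. rank_at x b k}"
    then obtain b where b: "b < 1" "rank_at x b k" by blast
    then have "k = r b" using rank_at_fun[OF b(2) r] by simp
    then show "k \<in> r ` {..<1}" using b(1) by simp
  qed (use r in force)
  then have "int_convex (r ` {..<1})" using int_convex_neg_ranks[OF inv, of x] by simp
  \<comment> \<open>Either \<open>x\<close> or \<open>star x\<close> is a negative element, so the
    interval of negative ranks is nonempty.\<close>
  moreover have "x < 1 \<or> star x < 1" using x inv_pos(3)[of x] by fastforce
  then have "r ` {..<1} \<noteq> {}" by auto
  ultimately show ?thesis using ranked by blast
qed

theorem lemma4p20: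
  shows "(star_involutive TYPE('a::idempotent_residuated_chain) \<longrightarrow>
            (\<forall>x::'a. x \<noteq> 1 \<longrightarrow> layer_convex monoidal_preorder (inv_closure x))) \<and>
         ((\<exists>x y::'a. x \<noteq> y) \<longrightarrow>
            (one_generated TYPE('a) \<and> star_involutive TYPE('a) \<longleftrightarrow> crownian TYPE('a)))"
proof (intro conjI impI allI iffI)
  fix x :: 'a
  assume "star_involutive TYPE('a)" "x \<noteq> 1"
  then show "layer_convex monoidal_preorder (inv_closure x)" by (rule layer_convex_inv_closure)
next
  assume "\<exists>x y::'a. x \<noteq> y" "one_generated TYPE('a) \<and> star_involutive TYPE('a)"
  then show "crownian TYPE('a)" by (simp only: crownian_iff_ranked ranked_if_one_generated)
next
  assume "crownian TYPE('a)"
  then obtain r N L where ranked: "ranked (monoidal_preorder :: 'a starred_enhanced_preorder) r N L"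
    and N: "N \<noteq> {}" "int_convex N"
    unfolding crownian_iff_ranked by blast
  show "one_generated TYPE('a)" by (rule one_generated_if_ranked[OF ranked N])
  show "star_involutive TYPE('a)" by (rule star_involutive_if_ranked[OF ranked])
qed

end
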